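(* Let $L>0$, $a>0$, $b_0>0$, $c_0>0$, and let $\mathcal{A}$ be the operator on $\mathcal{H}$ defined in the context, with constant damping coefficient $b(x)=b_0$ and constant coupling coefficient $c(x)=c_0$ for all $x\in(0,L)$. Then for every sufficiently small $\varepsilon>0$ the energy decay rate $t^{-\frac{2}{2-\varepsilon}}$ does not hold for all initial data in $D(\mathcal{A})$: there is no constant $C>0$ such that $$E(t)\le \frac{C}{t^{\frac{2}{2-\varepsilon}}}\|U_0\|_{D(\mathcal{A})}^2\qquad \forall\, t>0,\ \forall\, U_0\in D(\mathcal{A}),$$ where $E(t)=\frac12\|e^{t\mathcal{A}}U_0\|^2_{\mathcal{H}}$.
   Context: Functions are complex valued. The energy space is $\mathcal{H}=(H_0^1(0,L)\times L^2(0,L))^2$ with norm $\|(u,v,y,z)\|_{\mathcal{H}}^2=\int_0^L(|v|^2+a|u_x|^2+|z|^2+|y_x|^2)\,dx$. The unbounded operator $\mathcal{A}$ on $\mathcal{H}$ has domain $$D(\mathcal{A})=\{(u,v,y,z)\in\mathcal{H}:\ y\in H^2(0,L)\cap H_0^1(0,L),\ v,z\in H_0^1(0,L),\ (au_x+b(x)v_x)_x\in L^2(0,L)\}$$ and $\mathcal{A}(u,v,y,z)=(v,\ (au_x+b(x)v_x)_x-c(x)z,\ z,\ y_{xx}+c(x)v)$; here $b\equiv b_0$ and $c\equiv c_0$ on $(0,L)$. $\mathcal{A}$ generates a $C_0$-semigroup of contractions $(e^{t\mathcal{A}})_{t\ge0}$ on $\mathcal{H}$. $\|\cdot\|_{D(\mathcal{A})}$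 denotes the graph norm of $\mathcal{A}$. *)

theory Defs
  imports "HOL-Analysis.Analysis"
begin

text \<open>
  Elements of the Lebesgue and Sobolev spaces on (0,L) are represented by functions on the real
  line; only their values on (0,L) matter, and only up to almost everywhere equality. All
  conditions below are invariant under this equality.
\<close>

definition L2 :: "real \<Rightarrow> (real \<Rightarrow> complex) set" where
  "L2 L = {f. f \<in> borel_measurable (lebesgue_on {0<..<L}) \<and>
              integrable (lebesgue_on {0<..<L}) (\<lambda>x. (cmod (f x))\<^sup>2)}"

definition L2_norm :: "real \<Rightarrow> (real \<Rightarrow> complex) \<Rightarrow> real" where
  "L2_norm L f = sqrt (LINT x|lebesgue_on {0<..<L}. (cmod (f x))\<^sup>2)"

text \<open>Smooth functions with compact support in (0,L); \<open>D n\<close> is the derivative of order \<open>n\<close>.\<close>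

definition test_fun :: "real \<Rightarrow> (real \<Rightarrow> complex) \<Rightarrow> bool" where
  "test_fun L \<phi> \<longleftrightarrow>
     (\<exists>D :: nat \<Rightarrow> real \<Rightarrow> complex.
        D 0 = \<phi> \<and> (\<forall>n x. (D n has_vector_derivative D (Suc n) x) (at x))) \<and>
     closure {x. \<phi> x \<noteq> 0} \<subseteq> {0<..<L}"

definition has_weak_deriv :: "real \<Rightarrow> (real \<Rightarrow> complex) \<Rightarrow> (real \<Rightarrow> complex) \<Rightarrow> bool" where
  "has_weak_deriv L f g \<longleftrightarrow> f \<in> L2 L \<and> g \<in> L2 L \<and>
     (\<forall>\<phi>. test_fun L \<phi> \<longrightarrow>
        (LINT x|lebesgue_on {0<..<L}. f x * vector_derivative \<phi> (at x)) =
        - (LINT x|lebesgue_on {0<..<L}. g x * \<phi> x))"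

text \<open>A representative of the weak derivative, which is unique almost everywhere on (0,L).
  It is unspecified outside \<open>H1 L\<close>.\<close>

definition weak_deriv :: "real \<Rightarrow> (real \<Rightarrow> complex) \<Rightarrow> real \<Rightarrow> complex" where
  "weak_deriv L f = (SOME g. has_weak_deriv L f g)"

definition H1 :: "real \<Rightarrow> (real \<Rightarrow> complex) set" where
  "H1 L = {f. \<exists>g. has_weak_deriv L f g}"

definition H1_norm :: "real \<Rightarrow> (real \<Rightarrow> complex) \<Rightarrow> real" where
  "H1_norm L f = sqrt ((L2_norm L f)\<^sup>2 + (L2_norm L (weak_deriv L f))\<^sup>2)"

text \<open>The closure of the test functions in \<open>H1 L\<close>.\<close>

definition H10 :: "real \<Rightarrow> (real \<Rightarrow> complex) set" where
  "H10 L = {f \<in> H1 L. \<forall>e>0. \<exists>\<phi>. test_fun L \<phi> \<and> H1_norm L (\<lambda>x. f x - \<phi> x) < e}"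

definition H2 :: "real \<Rightarrow> (real \<Rightarrow> complex) set" where
  "H2 L = {f \<in> H1 L. weak_deriv L f \<in> H1 L}"

type_synonym state =
  "(real \<Rightarrow> complex) \<times> (real \<Rightarrow> complex) \<times> (real \<Rightarrow> complex) \<times> (real \<Rightarrow> complex)"

definition energy_space :: "real \<Rightarrow> state set" where
  "energy_space L = H10 L \<times> L2 L \<times> H10 L \<times> L2 L"

fun state_eq :: "real \<Rightarrow> state \<Rightarrow> state \<Rightarrow> bool" where
  "state_eq L (u, v, y, z) (u', v', y', z') \<longleftrightarrow>
     (AE x in lebesgue_on {0<..<L}. u x = u' x \<and> v x = v' x \<and> y x = y' x \<and> z x = z' x)"

fun state_add :: "state \<Rightarrow> state \<Rightarrow> state" where
  "state_add (u, v, y, z) (u', v', y', z') =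
     (\<lambda>x. u x + u' x, \<lambda>x. v x + v' x, \<lambda>x. y x + y' x, \<lambda>x. z x + z' x)"

fun state_scale :: "complex \<Rightarrow> state \<Rightarrow> state" where
  "state_scale k (u, v, y, z) = (\<lambda>x. k * u x, \<lambda>x. k * v x, \<lambda>x. k * y x, \<lambda>x. k * z x)"

definition state_diff :: "state \<Rightarrow> state \<Rightarrow> state" where
  "state_diff U V = state_add U (state_scale (-1) V)"

fun energy_norm :: "real \<Rightarrow> real \<Rightarrow> state \<Rightarrow> real" where
  "energy_norm L a (u, v, y, z) =
     sqrt (LINT x|lebesgue_on {0<..<L}.
             (cmod (v x))\<^sup>2 + a * (cmod (weak_deriv L u x))\<^sup>2
             + (cmod (z x))\<^sup>2 + (cmod (weak_deriv L y x))\<^sup>2)"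

definition flux :: "real \<Rightarrow> real \<Rightarrow> (real \<Rightarrow> real) \<Rightarrow>
    (real \<Rightarrow> complex) \<Rightarrow> (real \<Rightarrow> complex) \<Rightarrow> real \<Rightarrow> complex" where
  "flux L a b u v = (\<lambda>x. of_real a * weak_deriv L u x + of_real (b x) * weak_deriv L v x)"

definition A_dom :: "real \<Rightarrow> real \<Rightarrow> (real \<Rightarrow> real) \<Rightarrow> state set" where
  "A_dom L a b =
     {(u, v, y, z). (u, v, y, z) \<in> energy_space L \<and> y \<in> H2 L \<inter> H10 L \<and>
        v \<in> H10 L \<and> z \<in> H10 L \<and> flux L a b u v \<in> H1 L}"

fun A_op :: "real \<Rightarrow> real \<Rightarrow> (real \<Rightarrow> real) \<Rightarrow> (real \<Rightarrow> real) \<Rightarrow> state \<Rightarrow> state" where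
  "A_op L a b c (u, v, y, z) =
     (v,
      \<lambda>x. weak_deriv L (flux L a b u v) x - of_real (c x) * z x,
      z,
      \<lambda>x. weak_deriv L (weak_deriv L y) x + of_real (c x) * v x)"

definition graph_norm ::
    "real \<Rightarrow> real \<Rightarrow> (real \<Rightarrow> real) \<Rightarrow> (real \<Rightarrow> real) \<Rightarrow> state \<Rightarrow> real" where
  "graph_norm L a b c U = energy_norm L a U + energy_norm L a (A_op L a b c U)"

definition contraction_semigroup :: "real \<Rightarrow> real \<Rightarrow> (real \<Rightarrow> state \<Rightarrow> state) \<Rightarrow> bool" where
  "contraction_semigroup L a T \<longleftrightarrow>
     (\<forall>t\<ge>0. \<forall>U\<in>energy_space L. T t U \<in> energy_space L) \<and>
     (\<forall>t\<ge>0. \<forall>U\<in>energy_space L. \<forall>V\<in>energy_space L.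
        state_eq L U V \<longrightarrow> state_eq L (T t U) (T t V)) \<and>
     (\<forall>t\<ge>0. \<forall>U\<in>energy_space L. \<forall>V\<in>energy_space L.
        state_eq L (T t (state_add U V)) (state_add (T t U) (T t V))) \<and>
     (\<forall>t\<ge>0. \<forall>U\<in>energy_space L. \<forall>k.
        state_eq L (T t (state_scale k U)) (state_scale k (T t U))) \<and>
     (\<forall>t\<ge>0. \<forall>U\<in>energy_space L. energy_norm L a (T t U) \<le> energy_norm L a U) \<and>
     (\<forall>U\<in>energy_space L. state_eq L (T 0 U) U) \<and>
     (\<forall>s\<ge>0. \<forall>t\<ge>0. \<forall>U\<in>energy_space L. state_eq L (T (s + t) U) (T s (T t U))) \<and>
     (\<forall>U\<in>energy_space L.
        ((\<lambda>t. energy_norm L a (state_diff (T t U) U)) \<longlongrightarrow> 0) (at_right 0))"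

text \<open>The infinitesimal generator of \<open>T\<close>, as the graph of an operator on the energy space.\<close>

definition generator_graph ::
    "real \<Rightarrow> real \<Rightarrow> (real \<Rightarrow> state \<Rightarrow> state) \<Rightarrow> (state \<times> state) set" where
  "generator_graph L a T =
     {(U, F). U \<in> energy_space L \<and> F \<in> energy_space L \<and>
        ((\<lambda>h. energy_norm L a
                (state_diff (state_scale (of_real (1 / h)) (state_diff (T h U) U)) F))
           \<longlongrightarrow> 0) (at_right 0)}"

text \<open>\<open>T t\<close> is the operator exp(tA) on the energy space.\<close>

definition generates_contraction_semigroup ::
    "real \<Rightarrow> real \<Rightarrow> (real \<Rightarrow> real) \<Rightarrow> (real \<Rightarrow> real) \<Rightarrow> (real \<Rightarrow> state \<Rightarrow> state) \<Rightarrow> bool" where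
  "generates_contraction_semigroup L a b c T \<longleftrightarrow>
     contraction_semigroup L a T \<and>
     generator_graph L a T =
       {(U, F). U \<in> A_dom L a b \<and> F \<in> energy_space L \<and> state_eq L F (A_op L a b c U)}"

definition energy :: "real \<Rightarrow> real \<Rightarrow> (real \<Rightarrow> state \<Rightarrow> state) \<Rightarrow> state \<Rightarrow> real \<Rightarrow> real" where
  "energy L a T U0 t = 1 / 2 * (energy_norm L a (T t U0))\<^sup>2"

end

theory Submission
  imports Defs "HOL-Computational_Algebra.Fundamental_Theorem_Algebra"
begin

text \<open>
  The obstruction is a sequence of eigenvalues of the operator that approach the imaginary axis. For
  \<open>k = n \<pi> / L\<close> the function \<open>s x = sin (k x)\<close> lies in \<open>H10 L\<close>, and the operator maps the span of
  the four states that have one component \<open>s\<close> and three components 0 into itself. The vector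
  \<open>(\<alpha> s, l \<alpha> s, \<beta> s, l \<beta> s)\<close> with \<open>\<alpha> = l\<^sup>2 + k\<^sup>2\<close> and \<open>\<beta> = c0 l\<close> is an eigenvector for the eigenvalue
  \<open>l\<close> exactly when \<open>(l\<^sup>2 + k\<^sup>2) (l\<^sup>2 + (a + b0 l) k\<^sup>2) + c0\<^sup>2 l\<^sup>2 = 0\<close>. The first factor belongs to the
  undamped wave equation for \<open>y\<close> and vanishes at \<open>l = \<i> k\<close>. There the second factor has size
  \<open>b0 k\<^sup>3\<close>: at high frequency the damping makes the equation for \<open>u\<close> so stiff that \<open>u\<close> hardly
  responds to \<open>y\<close>. The coupling term therefore moves the root only by \<open>O(k\<^sup>-\<^sup>2)\<close>: there is an
  eigenvalue with \<open>\<bar>l - \<i> k\<bar> \<le> K / k\<^sup>2\<close>, where \<open>K = 4 c0\<^sup>2 / b0\<close> (lemma \<open>characteristic_root\<close>).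

  The semigroup multiplies an eigenvector by \<open>exp (l t)\<close> (lemma \<open>semigroup_eigenvector\<close>). At time
  \<open>t = k\<^sup>2\<close> the fraction of the energy that is left is therefore at least \<open>exp (- 2 K)\<close>, whatever \<open>k\<close>
  is, whereas a decay rate \<open>t\<^sup>-\<^sup>p\<close> bounds it by a constant times
  \<open>k\<^sup>-\<^sup>2\<^sup>p (1 + \<bar>l\<bar>)\<^sup>2\<close>, which is of order \<open>k\<^sup>2\<^sup>-\<^sup>2\<^sup>p\<close>. For \<open>p > 1\<close> this tends to 0 as \<open>k\<close> grows, a
  contradiction; and \<open>p = 2 / (2 - \<epsilon>)\<close> exceeds 1 for \<open>0 < \<epsilon> < 1\<close>.

  Most of the work makes these computations legitimate for weak derivatives that are chosen
  arbitrarily within their class of almost everywhere equal functions. Weak derivatives are unique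
  almost everywhere (lemma \<open>fundamental_lemma\<close>), hence linear, so that the energy norm is a seminorm;
  and \<open>s\<close> is a limit of test functions in the norm of \<open>H1 L\<close> (lemma \<open>sin_H10\<close>).
\<close>

section \<open>Smooth functions and cut-offs\<close>

definition smooth :: "(real \<Rightarrow> complex) \<Rightarrow> bool" where
  "smooth f \<longleftrightarrow> (\<exists>D :: nat \<Rightarrow> real \<Rightarrow> complex.
     D 0 = f \<and> (\<forall>n x. (D n has_vector_derivative D (Suc n) x) (at x)))"

lemma test_fun_iff: "test_fun L \<phi> \<longleftrightarrow> smooth \<phi> \<and> closure {x. \<phi> x \<noteq> 0} \<subseteq> {0<..<L}"
  by (simp add: test_fun_def smooth_def)

lemma smooth_lincomb:
  assumes "smooth f" "smooth g"
  shows "smooth (\<lambda>x. f x + c * g x)"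
proof -
  obtain D E where
    "D 0 = f" "\<And>n x. (D n has_vector_derivative D (Suc n) x) (at x)"
    "E 0 = g" "\<And>n x. (E n has_vector_derivative E (Suc n) x) (at x)"
    using assms unfolding smooth_def by metis
  then show ?thesis
    unfolding smooth_def
    by (intro exI[of _ "\<lambda>n x. D n x + c * E n x"])
      (auto intro!: has_vector_derivative_add has_vector_derivative_mult_right)
qed

lemma
  assumes "smooth f"
  shows smooth_has_derivative: "(f has_vector_derivative vector_derivative f (at x)) (at x)"
    and smooth_continuous_derivative: "continuous_on UNIV (\<lambda>x. vector_derivative f (at x))"
proof -
  obtain D where D: "D 0 = f" "\<And>n x. (D n has_vector_derivative D (Suc n) x) (at x)"
    using assms unfolding smooth_def by metis
  have f: "(f has_vector_derivative D 1 x) (at x)" for x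
    using D(1) D(2)[of 0] by simp
  then have D1: "D 1 = (\<lambda>x. vector_derivative f (at x))"
    by (intro ext vector_derivative_at[symmetric] f)
  show "(f has_vector_derivative vector_derivative f (at x)) (at x)"
    using f D1 by simp
  have "continuous_on UNIV (D 1)"
    by (rule continuous_on_vector_derivative) (use D(2)[of 1] in \<open>auto intro: has_vector_derivative_at_within\<close>)
  then show "continuous_on UNIV (\<lambda>x. vector_derivative f (at x))"
    using D1 by simp
qed

text \<open>
  For \<open>p = 1\<close> this is the standard smooth function that is flat at 0; the polynomial factor makes the
  family closed under differentiation.
\<close>

definition flat :: "real poly \<Rightarrow> real \<Rightarrow> real \<Rightarrow> real" where
  "flat p s x = (if x > 0 then poly p (1 / x) * exp (- s / x) else 0)"

lemma poly_exp_tendsto_0: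
  fixes p :: "real poly"
  assumes "s > 0"
  shows "((\<lambda>r. poly p r * exp (- s * r)) \<longlongrightarrow> 0) at_top"
proof -
  have mono: "((\<lambda>r. r ^ k * exp (- s * r)) \<longlongrightarrow> 0) at_top" for k
  proof -
    have "filterlim (\<lambda>r. s * r) at_top at_top"
      using assms by (intro filterlim_tendsto_pos_mult_at_top[OF tendsto_const] filterlim_ident)
    from filterlim_compose[OF tendsto_power_div_exp_0 this, of k]
    have "((\<lambda>r. 1 / s ^ k * ((s * r) ^ k / exp (s * r))) \<longlongrightarrow> 1 / s ^ k * 0) at_top"
      by (intro tendsto_intros)
    moreover have "1 / s ^ k * ((s * r) ^ k / exp (s * r)) = r ^ k * exp (- s * r)" for r
      using assms by (simp add: power_mult_distrib exp_minus divide_inverse)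
    ultimately show ?thesis by simp
  qed
  have "((\<lambda>r. \<Sum>i\<le>degree p. coeff p i * (r ^ i * exp (- s * r))) \<longlongrightarrow> (\<Sum>i\<le>degree p. coeff p i * 0)) at_top"
    by (intro tendsto_intros mono)
  then show ?thesis
    by (simp add: poly_altdef sum_distrib_right mult.assoc)
qed

text \<open>
  Away from 0 this is calculus. At 0 the difference quotient from the right is a polynomial in \<open>1 / x\<close>
  times \<open>exp (- s / x)\<close>, and the exponential wins.
\<close>

lemma flat_has_derivative:
  assumes s: "s > 0"
  shows "(flat p s has_real_derivative flat ([:0, 0, 1:] * (smult s p - pderiv p)) s x) (at x)"
proof -
  consider "x > 0" | "x < 0" | "x = 0" by linarith
  then show ?thesis
  proof cases
    case 1
    have "((\<lambda>x. poly p (1 / x) * exp (- s / x)) has_real_derivative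
        flat ([:0, 0, 1:] * (smult s p - pderiv p)) s x) (at x)"
      using 1 unfolding flat_def
      by (auto intro!: derivative_eq_intros simp: field_simps power2_eq_square)
    then show ?thesis
      by (rule has_field_derivative_transform_within_open[of _ _ _ "{0<..}"]) (use 1 in \<open>auto simp: flat_def\<close>)
  next
    case 2
    have "((\<lambda>x. 0) has_real_derivative flat ([:0, 0, 1:] * (smult s p - pderiv p)) s x) (at x)"
      using 2 by (simp add: flat_def)
    then show ?thesis
      by (rule has_field_derivative_transform_within_open[of _ _ _ "{..<0}"]) (use 2 in \<open>auto simp: flat_def\<close>)
  next
    case 3
    have "((\<lambda>r. poly ([:0, 1:] * p) r * exp (- s * r)) \<longlongrightarrow> 0) at_top"
      by (rule poly_exp_tendsto_0[OF s])
    from filterlim_compose[OF this filterlim_inverse_at_top_right]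
    have "((\<lambda>h. poly ([:0, 1:] * p) (inverse h) * exp (- s * inverse h)) \<longlongrightarrow> 0) (at_right 0)" .
    then have "((\<lambda>h. flat p s h / h) \<longlongrightarrow> 0) (at_right 0)"
      by (rule tendsto_cong[THEN iffD1, rotated])
        (auto simp: flat_def eventually_at_right_field divide_inverse intro!: exI[of _ 1])
    moreover have "((\<lambda>h. flat p s h / h) \<longlongrightarrow> 0) (at_left 0)"
      by (rule tendsto_eventually) (auto simp: flat_def eventually_at_left_field intro!: exI[of _ "-1"])
    ultimately have "((\<lambda>h. flat p s h / h) \<longlongrightarrow> 0) (at 0)"
      by (simp add: filterlim_split_at)
    then show ?thesis
      using 3 by (simp add: DERIV_def flat_def)
  qed
qed

text \<open>
  An algebra of functions that contains the derivative of each of its members, so that all of them are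
  smooth. This avoids formulas for derivatives of higher order. It contains the cut-off functions and
  the products of these with sines and constants.
\<close>

inductive_set elementary :: "(real \<Rightarrow> complex) set" where
  flat_right: "s > 0 \<Longrightarrow> (\<lambda>x. of_real (flat p s (x - c))) \<in> elementary"
| flat_left: "s > 0 \<Longrightarrow> (\<lambda>x. of_real (flat p s (d - x))) \<in> elementary"
| sin: "(\<lambda>x. of_real (sin (k * x))) \<in> elementary"
| cos: "(\<lambda>x. of_real (cos (k * x))) \<in> elementary"
| const: "(\<lambda>x. c) \<in> elementary"
| add: "f \<in> elementary \<Longrightarrow> g \<in> elementary \<Longrightarrow> (\<lambda>x. f x + g x) \<in> elementary"
| mult: "f \<in> elementary \<Longrightarrow> g \<in> elementary \<Longrightarrow> (\<lambda>x. f x * g x) \<in> elementary"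

lemma has_vector_derivative_of_real_field:
  assumes "(f has_real_derivative D) (at x)"
  shows "((\<lambda>x. complex_of_real (f x)) has_vector_derivative of_real D) (at x)"
  using assms by (simp add: has_vector_derivative_of_real has_real_derivative_iff_has_vector_derivative)

lemma elementary_deriv:
  assumes "f \<in> elementary"
  shows "\<exists>g\<in>elementary. \<forall>x. (f has_vector_derivative g x) (at x)"
  using assms
proof induction
  case (flat_right s p c)
  have "((\<lambda>x. flat p s (x - c)) has_real_derivative
      flat ([:0, 0, 1:] * (smult s p - pderiv p)) s (x - c) * 1) (at x)" for x
    by (rule DERIV_chain'[OF _ flat_has_derivative[OF flat_right], of "\<lambda>x. x - c"])
      (auto intro!: derivative_eq_intros)
  note D = has_vector_derivative_of_real_field[OF this, unfolded of_real_mult]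
  show ?case
    by (rule bexI, rule allI, rule D) (intro elementary.intros flat_right)
next
  case (flat_left s p d)
  have "((\<lambda>x. flat p s (d - x)) has_real_derivative
      flat ([:0, 0, 1:] * (smult s p - pderiv p)) s (d - x) * (-1)) (at x)" for x
    by (rule DERIV_chain'[OF _ flat_has_derivative[OF flat_left], of "\<lambda>x. d - x"])
      (auto intro!: derivative_eq_intros)
  note D = has_vector_derivative_of_real_field[OF this, unfolded of_real_mult]
  show ?case
    by (rule bexI, rule allI, rule D) (intro elementary.intros flat_left)
next
  case (sin k)
  have "((\<lambda>x. sin (k * x)) has_real_derivative k * cos (k * x)) (at x)" for x
    by (auto intro!: derivative_eq_intros)
  note D = has_vector_derivative_of_real_field[OF this, unfolded of_real_mult]
  show ?case
    by (rule bexI, rule allI, rule D) (intro elementary.intros)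
next
  case (cos k)
  have "((\<lambda>x. cos (k * x)) has_real_derivative - k * sin (k * x)) (at x)" for x
    by (auto intro!: derivative_eq_intros)
  note D = has_vector_derivative_of_real_field[OF this, unfolded of_real_mult]
  show ?case
    by (rule bexI, rule allI, rule D) (intro elementary.intros)
next
  case (const c)
  show ?case
    by (intro bexI[of _ "\<lambda>x. 0"] allI has_vector_derivative_const elementary.const)
next
  case (add f g)
  then obtain f' g' where
    "f' \<in> elementary" "g' \<in> elementary"
    "\<forall>x. (f has_vector_derivative f' x) (at x)" "\<forall>x. (g has_vector_derivative g' x) (at x)"
    by blast
  then show ?case
    by (intro bexI[of _ "\<lambda>x. f' x + g' x"] allI has_vector_derivative_add elementary.add) auto
next
  case (mult f g)
  then obtain f' g' where
    "f' \<in> elementary" "g' \<in> elementary"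
    "\<forall>x. (f has_vector_derivative f' x) (at x)" "\<forall>x. (g has_vector_derivative g' x) (at x)"
    by blast
  with mult.hyps show ?case
    by (intro bexI[of _ "\<lambda>x. f x * g' x + f' x * g x"] allI has_vector_derivative_mult
          elementary.add elementary.mult) auto
qed

lemma smooth_elementary:
  assumes f: "f \<in> elementary"
  shows "smooth f"
proof -
  obtain d where d: "\<And>f. f \<in> elementary \<Longrightarrow>
      d f \<in> elementary \<and> (\<forall>x. (f has_vector_derivative d f x) (at x))"
    using elementary_deriv by metis
  have "(d ^^ n) f \<in> elementary" for n
    by (induction n) (use f d in auto)
  then show ?thesis
    unfolding smooth_def using d by (intro exI[of _ "\<lambda>n. (d ^^ n) f"]) auto
qed


text \<open>
  The cut-off function \<open>exp (- s / (x - c) - s / (d - x))\<close> on the interval \<open>(c, d)\<close>, which tends to the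
  indicator function of this interval as \<open>s\<close> tends to 0.
\<close>

definition bump :: "real \<Rightarrow> real \<Rightarrow> real \<Rightarrow> real \<Rightarrow> real" where
  "bump s c d x = flat 1 s (x - c) * flat 1 s (d - x)"

lemma flat_1_bounds: "s > 0 \<Longrightarrow> 0 \<le> flat 1 s x \<and> flat 1 s x \<le> 1"
  by (simp add: flat_def)

lemma flat_1_tendsto: "((\<lambda>s. flat 1 s x) \<longlongrightarrow> (if x > 0 then 1 else 0)) (at_right 0)"
  by (auto simp: flat_def intro!: tendsto_eq_intros)

lemma test_fun_mult_bump:
  assumes "s > 0" "0 < c" "d < L" "g \<in> elementary"
  shows "test_fun L (\<lambda>x. g x * of_real (bump s c d x))"
  unfolding test_fun_iff
proof
  have "(\<lambda>x. g x * (of_real (flat 1 s (x - c)) * of_real (flat 1 s (d - x)))) \<in> elementary"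
    using assms by (intro elementary.intros) auto
  then show "smooth (\<lambda>x. g x * of_real (bump s c d x))"
    by (auto simp: bump_def intro: smooth_elementary)
  have "closure {x. g x * of_real (bump s c d x) \<noteq> 0} \<subseteq> {c..d}"
    by (rule closure_minimal) (auto simp: bump_def flat_def split: if_splits)
  then show "closure {x. g x * of_real (bump s c d x) \<noteq> 0} \<subseteq> {0<..<L}"
    using assms by auto
qed

section \<open>Square integrable functions\<close>

definition sq_integrable :: "'a measure \<Rightarrow> ('a \<Rightarrow> 'b::{real_normed_vector, second_countable_topology}) \<Rightarrow> bool" where
  "sq_integrable M f \<longleftrightarrow> f \<in> borel_measurable M \<and> integrable M (\<lambda>x. (norm (f x))\<^sup>2)"

definition norm2 :: "'a measure \<Rightarrow> ('a \<Rightarrow> 'b::{real_normed_vector, second_countable_topology}) \<Rightarrow> real" where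
  "norm2 M f = sqrt (LINT x|M. (norm (f x))\<^sup>2)"

text \<open>
  Integrating this inequality with \<open>A\<close> and \<open>B\<close> equal to the norms of two functions gives Minkowski's
  inequality, since the right-hand side becomes \<open>(A + B)\<^sup>2\<close>.
\<close>

lemma norm_add_sq_le:
  fixes x y :: "'a::real_normed_vector"
  assumes "A > 0" "B > 0"
  shows "(norm (x + y))\<^sup>2 \<le> (A + B) / A * (norm x)\<^sup>2 + (A + B) / B * (norm y)\<^sup>2"
proof -
  have "(norm (x + y))\<^sup>2 \<le> (norm x + norm y)\<^sup>2"
    by (intro power_mono norm_triangle_ineq) auto
  also have "\<dots> \<le> (A + B) / A * (norm x)\<^sup>2 + (A + B) / B * (norm y)\<^sup>2"
  proof -
    have "0 \<le> (B * norm x - A * norm y)\<^sup>2 / (A * B)" using assms by simp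
    also have "\<dots> = (A + B) / A * (norm x)\<^sup>2 + (A + B) / B * (norm y)\<^sup>2 - (norm x + norm y)\<^sup>2"
      using assms by (simp add: field_simps power2_eq_square)
    finally show ?thesis by simp
  qed
  finally show ?thesis .
qed

lemma sq_integrable_add:
  assumes "sq_integrable M f" "sq_integrable M g"
  shows "sq_integrable M (\<lambda>x. f x + g x)"
proof -
  have [measurable]: "f \<in> borel_measurable M" "g \<in> borel_measurable M"
    using assms by (auto simp: sq_integrable_def)
  have "integrable M (\<lambda>x. (norm (f x + g x))\<^sup>2)"
  proof (rule Bochner_Integration.integrable_bound)
    show "integrable M (\<lambda>x. 2 * (norm (f x))\<^sup>2 + 2 * (norm (g x))\<^sup>2)"
      using assms by (auto simp: sq_integrable_def)
    show "AE x in M. norm ((norm (f x + g x))\<^sup>2) \<le> norm (2 * (norm (f x))\<^sup>2 + 2 * (norm (g x))\<^sup>2)"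
      using norm_add_sq_le[of 1 1] by (intro AE_I2) auto
  qed measurable
  then show ?thesis by (simp add: sq_integrable_def)
qed

lemma norm2_triangle:
  assumes "sq_integrable M f" "sq_integrable M g"
  shows "norm2 M (\<lambda>x. f x + g x) \<le> norm2 M f + norm2 M g"
proof (rule field_le_epsilon)
  fix e :: real assume e: "e > 0"
  \<comment> \<open>The summand \<open>e / 2\<close> keeps both weights positive when a norm vanishes.\<close>
  define A where "A = norm2 M f + e / 2"
  define B where "B = norm2 M g + e / 2"
  have nn: "norm2 M f \<ge> 0" "norm2 M g \<ge> 0" by (auto simp: norm2_def)
  then have pos: "A > 0" "B > 0" using e by (auto simp: A_def B_def)
  have *: "(LINT x|M. (norm (f x))\<^sup>2) \<le> A\<^sup>2" "(LINT x|M. (norm (g x))\<^sup>2) \<le> B\<^sup>2"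
  proof -
    have "(norm2 M f)\<^sup>2 \<le> A\<^sup>2" "(norm2 M g)\<^sup>2 \<le> B\<^sup>2"
      using nn e by (auto simp: A_def B_def intro!: power_mono)
    then show "(LINT x|M. (norm (f x))\<^sup>2) \<le> A\<^sup>2" "(LINT x|M. (norm (g x))\<^sup>2) \<le> B\<^sup>2"
      by (auto simp: norm2_def)
  qed
  have "(LINT x|M. (norm (f x + g x))\<^sup>2) \<le>
      (LINT x|M. (A + B) / A * (norm (f x))\<^sup>2 + (A + B) / B * (norm (g x))\<^sup>2)"
    using assms sq_integrable_add[OF assms] norm_add_sq_le[OF pos]
    by (intro integral_mono) (auto simp: sq_integrable_def)
  also have "\<dots> = (A + B) / A * (LINT x|M. (norm (f x))\<^sup>2) + (A + B) / B * (LINT x|M. (norm (g x))\<^sup>2)"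
    using assms by (simp add: sq_integrable_def)
  also have "\<dots> \<le> (A + B) / A * A\<^sup>2 + (A + B) / B * B\<^sup>2"
    using pos * by (intro add_mono mult_left_mono) auto
  also have "\<dots> = (A + B)\<^sup>2"
    using pos by (simp add: field_simps power2_eq_square)
  finally have "norm2 M (\<lambda>x. f x + g x) \<le> A + B"
    unfolding norm2_def using pos by (simp add: real_le_lsqrt)
  then show "norm2 M (\<lambda>x. f x + g x) \<le> norm2 M f + norm2 M g + e"
    by (simp add: A_def B_def)
qed

lemma norm2_cong_AE:
  assumes "f \<in> borel_measurable M" "g \<in> borel_measurable M" "AE x in M. f x = g x"
  shows "norm2 M f = norm2 M g"
proof -
  note [measurable] = assms(1,2)
  have "(LINT x|M. (norm (f x))\<^sup>2) = (LINT x|M. (norm (g x))\<^sup>2)"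
    using assms(3) by (intro integral_cong_AE) auto
  then show ?thesis by (simp add: norm2_def)
qed

lemma norm2_norm_scale:
  assumes "\<And>x. norm (f x) = c * norm (g x)" "c \<ge> 0"
  shows "norm2 M f = c * norm2 M g"
  using assms by (simp add: norm2_def power_mult_distrib real_sqrt_mult)

abbreviation interval_measure :: "real \<Rightarrow> real measure" where
  "interval_measure L \<equiv> lebesgue_on {0<..<L}"

lemma L2_iff: "f \<in> L2 L \<longleftrightarrow> sq_integrable (interval_measure L) f"
  by (simp add: L2_def sq_integrable_def)

lemma L2_norm_eq: "L2_norm L f = norm2 (interval_measure L) f"
  by (simp add: L2_norm_def norm2_def)

lemma L2_add: "f \<in> L2 L \<Longrightarrow> g \<in> L2 L \<Longrightarrow> (\<lambda>x. f x + g x) \<in> L2 L"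
  by (simp add: L2_iff sq_integrable_add)

lemma L2_scale: "f \<in> L2 L \<Longrightarrow> (\<lambda>x. c * f x) \<in> L2 L"
  by (auto simp: L2_def norm_mult power_mult_distrib)

lemma L2_measurable: "f \<in> L2 L \<Longrightarrow> f \<in> borel_measurable (interval_measure L)"
  by (simp add: L2_def)

lemma finite_interval_measure: "finite_measure (interval_measure L)"
  by (intro finite_measure_lebesgue_on) simp

lemma integrable_continuous_on_interval:
  fixes f :: "real \<Rightarrow> 'b::euclidean_space"
  assumes f: "continuous_on UNIV f"
  shows "integrable (interval_measure L) f"
proof -
  interpret finite_measure "interval_measure L" by (rule finite_interval_measure)
  have "compact (f ` {0..L})"
    using f by (intro compact_continuous_image) (auto intro: continuous_on_subset)
  then obtain B where B: "\<And>x. x \<in> {0..L} \<Longrightarrow> norm (f x) \<le> B"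
    using compact_imp_bounded[of "f ` {0..L}"] unfolding bounded_iff by blast
  show ?thesis
  proof (rule integrable_const_bound)
    show "AE x in interval_measure L. norm (f x) \<le> B"
      using B by (intro AE_I2) auto
    show "f \<in> borel_measurable (interval_measure L)"
      using f by (intro continuous_imp_measurable_on_sets_lebesgue)
        (auto intro: continuous_on_subset)
  qed
qed

lemma L2_continuous:
  assumes "continuous_on UNIV f"
  shows "f \<in> L2 L"
proof -
  have "continuous_on UNIV (\<lambda>x. (cmod (f x))\<^sup>2)"
    using assms by (intro continuous_intros)
  from integrable_continuous_on_interval[OF this] borel_measurable_integrable[OF integrable_continuous_on_interval[OF assms]]
  show ?thesis unfolding L2_def by simp
qed

lemma integrable_mult_L2:
  assumes "f \<in> L2 L" "g \<in> L2 L"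
  shows "integrable (interval_measure L) (\<lambda>x. f x * g x)"
proof (rule Bochner_Integration.integrable_bound)
  note [measurable] = assms[THEN L2_measurable]
  show "integrable (interval_measure L) (\<lambda>x. (cmod (f x))\<^sup>2 + (cmod (g x))\<^sup>2)"
    using assms unfolding L2_def by (intro Bochner_Integration.integrable_add) blast+
  have "cmod (f x) * cmod (g x) \<le> (cmod (f x))\<^sup>2 + (cmod (g x))\<^sup>2" for x
  proof -
    have "2 * (cmod (f x) * cmod (g x)) \<le> (cmod (f x))\<^sup>2 + (cmod (g x))\<^sup>2"
      using sum_squares_bound[of "cmod (f x)" "cmod (g x)"] by (simp add: mult.assoc)
    moreover have "0 \<le> cmod (f x) * cmod (g x)" by simp
    ultimately show ?thesis by linarith
  qed
  then show "AE x in interval_measure L. norm (f x * g x) \<le> norm ((cmod (f x))\<^sup>2 + (cmod (g x))\<^sup>2)"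
    by (intro AE_I2) (auto simp: norm_mult)
  show "(\<lambda>x. f x * g x) \<in> borel_measurable (interval_measure L)" by measurable
qed

lemma integral_deriv_eq_0:
  fixes F F' :: "real \<Rightarrow> complex"
  assumes "L > 0" "\<And>x. (F has_vector_derivative F' x) (at x)" "continuous_on UNIV F'"
    and "F 0 = 0" "F L = 0"
  shows "(LINT x|interval_measure L. F' x) = 0"
proof -
  have "(F' has_integral F L - F 0) {0..L}"
    using assms by (intro fundamental_theorem_of_calculus) (auto intro: has_vector_derivative_at_within)
  then have "integral {0<..<L} F' = 0"
    using assms by (simp add: integral_unique flip: integral_open_interval_real)
  then show ?thesis
    using lebesgue_integral_eq_integral[OF integrable_continuous_on_interval[OF assms(3)], of L] by simp
qed

section \<open>The fundamental lemma of the calculus of variations\<close>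

lemma test_fun_smooth: "test_fun L \<phi> \<Longrightarrow> smooth \<phi>"
  by (simp add: test_fun_iff)

lemma test_fun_zero:
  assumes "test_fun L \<phi>" "x \<notin> {0<..<L}"
  shows "\<phi> x = 0"
proof (rule ccontr)
  assume "\<phi> x \<noteq> 0"
  then have "x \<in> closure {x. \<phi> x \<noteq> 0}"
    by (rule subsetD[OF closure_subset CollectI])
  moreover have "closure {x. \<phi> x \<noteq> 0} \<subseteq> {0<..<L}"
    using assms(1) by (simp add: test_fun_def)
  ultimately have "x \<in> {0<..<L}" by (rule subsetD[rotated])
  with assms(2) show False by (rule notE)
qed

lemma smooth_continuous: "smooth f \<Longrightarrow> continuous_on UNIV f"
  by (rule continuous_on_vector_derivative, rule has_vector_derivative_at_within, rule smooth_has_derivative)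

lemma test_fun_L2: "test_fun L \<phi> \<Longrightarrow> \<phi> \<in> L2 L"
  by (rule L2_continuous, rule smooth_continuous, rule test_fun_smooth)

lemma test_fun_deriv_L2: "test_fun L \<phi> \<Longrightarrow> (\<lambda>x. vector_derivative \<phi> (at x)) \<in> L2 L"
  by (rule L2_continuous, rule smooth_continuous_derivative, rule test_fun_smooth)

lemma bump_tendsto:
  "(\<lambda>n. bump (inverse (real (Suc n))) c d x) \<longlonglongrightarrow> indicator {c<..<d} x"
proof -
  have lim: "filterlim (\<lambda>n. inverse (real (Suc n))) (at_right 0) sequentially"
    unfolding filterlim_at using LIMSEQ_inverse_real_of_nat by auto
  have "(\<lambda>n. bump (inverse (real (Suc n))) c d x) \<longlonglongrightarrow>
      (if x - c > 0 then 1 else 0) * (if d - x > 0 then 1 else 0)"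
    unfolding bump_def
    by (intro tendsto_mult filterlim_compose[OF flat_1_tendsto lim])
  moreover have "(if x - c > 0 then 1 else 0) * (if d - x > 0 then 1 else 0) = (indicator {c<..<d} x :: real)"
    by (auto simp: indicator_def)
  ultimately show ?thesis by metis
qed

lemma bump_bounds: "s > 0 \<Longrightarrow> 0 \<le> bump s c d x \<and> bump s c d x \<le> 1"
  using flat_1_bounds[of s] by (auto simp: bump_def intro: mult_le_one)

text \<open>
  The cut-off functions are test functions bounded by 1 that converge to the indicator function of
  \<open>(c, d)\<close>, so dominated convergence applies.
\<close>

lemma integral_eq_0_on_subintervals:
  assumes g: "g \<in> L2 L" and ort: "\<And>\<phi>. test_fun L \<phi> \<Longrightarrow> (LINT x|interval_measure L. g x * \<phi> x) = 0"
    and cd: "0 < c" "d < L"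
  shows "integral {c..d} g = 0"
proof -
  note [measurable] = L2_measurable[OF g]
  have int: "integrable (interval_measure L) g"
    using integrable_mult_L2[OF g, of "\<lambda>x. 1"] L2_continuous[of "\<lambda>x. 1"] by auto
  define \<phi> where "\<phi> n x = complex_of_real (bump (inverse (real (Suc n))) c d x)" for n x
  have test: "test_fun L (\<phi> n)" for n
    using test_fun_mult_bump[OF _ cd elementary.const[of 1], of "inverse (real (Suc n))"]
    by (simp add: \<phi>_def[abs_def])
  note [measurable] = test_fun_L2[OF test, THEN L2_measurable]
  have meas: "(\<lambda>x. g x * of_real (indicat_real {c<..<d} x)) \<in> borel_measurable (interval_measure L)"
  proof -
    have "{x \<in> space (interval_measure L). x \<in> {c<..<d}} = {c<..<d} \<inter> {0<..<L}"
      by auto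
    also have "\<dots> \<in> sets (interval_measure L)"
      by (subst sets_restrict_space_iff) auto
    finally have "indicat_real {c<..<d} \<in> borel_measurable (interval_measure L)"
      by (rule borel_measurable_indicator')
    then show ?thesis by measurable
  qed
  have "(\<lambda>n. LINT x|interval_measure L. g x * \<phi> n x) \<longlonglongrightarrow>
      (LINT x|interval_measure L. g x * of_real (indicat_real {c<..<d} x))"
  proof (rule integral_dominated_convergence)
    show "integrable (interval_measure L) (\<lambda>x. norm (g x))" using int by simp
    show "AE x in interval_measure L. (\<lambda>n. g x * \<phi> n x) \<longlonglongrightarrow> g x * of_real (indicat_real {c<..<d} x)"
      unfolding \<phi>_def by (intro AE_I2 tendsto_intros bump_tendsto)
    show "AE x in interval_measure L. norm (g x * \<phi> n x) \<le> norm (g x)" for n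
      using bump_bounds by (intro AE_I2) (auto simp: \<phi>_def norm_mult intro!: mult_left_le)
  qed (use meas in measurable)
  then have "(\<lambda>n. 0) \<longlonglongrightarrow> (LINT x|interval_measure L. g x * of_real (indicat_real {c<..<d} x))"
    by (simp only: ort[OF test])
  then have "(LINT x|interval_measure L. g x * of_real (indicat_real {c<..<d} x)) = 0"
    by (simp only: LIMSEQ_const_iff)
  moreover have "integrable (interval_measure L) (\<lambda>x. g x * of_real (indicat_real {c<..<d} x))"
    by (rule Bochner_Integration.integrable_bound[OF int meas])
      (auto simp: norm_mult indicator_def)
  moreover have "(\<lambda>x. g x * of_real (indicat_real {c<..<d} x)) = (\<lambda>x. if x \<in> {c<..<d} then g x else 0)"
    by (auto simp: indicator_def)
  ultimately have "((\<lambda>x. if x \<in> {c<..<d} then g x else 0) has_integral 0) {0<..<L}"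
    using has_integral_integral_lebesgue_on[of "{0<..<L}"] by fastforce
  then have "(g has_integral 0) {c<..<d}"
    using cd by (subst (asm) has_integral_restrict) auto
  then show ?thesis
    by (simp add: integral_unique integral_open_interval_real)
qed

text \<open>
  Almost every point is a right Lebesgue point of \<open>g\<close>: there \<open>g x\<close> is the limit of the averages of
  \<open>g\<close> over the intervals \<open>[x, x + h]\<close>, and these averages are 0.
\<close>

lemma fundamental_lemma:
  assumes g: "g \<in> L2 L" and ort: "\<And>\<phi>. test_fun L \<phi> \<Longrightarrow> (LINT x|interval_measure L. g x * \<phi> x) = 0"
  shows "AE x in interval_measure L. g x = 0"
proof -
  define G where "G x = (if x \<in> {0<..<L} then g x else 0)" for x
  have "integrable (interval_measure L) g"
    using integrable_mult_L2[OF g, of "\<lambda>x. 1"] L2_continuous[of "\<lambda>x. 1"] by auto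
  then have "g integrable_on {0<..<L}"
    using has_integral_integral_lebesgue_on[of "{0<..<L}"] by fastforce
  then have "G integrable_on UNIV"
    unfolding G_def by (subst integrable_restrict_UNIV)
  then have "G integrable_on cbox a b" for a b
    by (rule integrable_on_subcbox) auto
  then obtain N where N: "negligible N"
    "\<And>x e. \<lbrakk>x \<notin> N; 0 < e\<rbrakk> \<Longrightarrow> \<exists>d>0. \<forall>h. 0 < h \<and> h < d \<longrightarrow>
        norm (integral (cbox x (x + h *\<^sub>R One)) G /\<^sub>R h ^ DIM(real) - G x) < e"
    using integrable_ccontinuous_explicit by metis
  have "g x = 0" if x: "x \<in> {0<..<L}" "x \<notin> N" for x
  proof (rule ccontr)
    assume "g x \<noteq> 0"
    then obtain d where d: "d > 0" "\<forall>h. 0 < h \<and> h < d \<longrightarrow>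
        norm (integral (cbox x (x + h *\<^sub>R One)) G /\<^sub>R h ^ DIM(real) - G x) < norm (g x)"
      using N(2)[OF x(2), of "norm (g x)"] by auto
    define h where "h = min (d / 2) ((L - x) / 2)"
    have h: "0 < h" "h < d" "x + h < L" using d x by (auto simp: h_def min_def field_simps)
    have "integral {x..x + h} G = integral {x..x + h} g"
      by (rule integral_cong) (use x h in \<open>auto simp: G_def\<close>)
    also have "\<dots> = 0"
      by (rule integral_eq_0_on_subintervals[OF g ort]) (use x h in auto)
    finally show False
      using d(2)[rule_format, of h] h x by (simp add: G_def)
  qed
  moreover have "AE x in lebesgue. x \<notin> N"
    using N(1) by (simp add: AE_not_in negligible_iff_null_sets)
  ultimately show ?thesis
    by (subst AE_restrict_space_iff) auto
qed

section \<open>Weak derivatives and Sobolev spaces\<close>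

text \<open>
  Integration by parts: \<open>f \<phi>\<close> vanishes at both ends of the interval because \<open>\<phi>\<close> does.
\<close>

lemma has_weak_deriv_C1:
  assumes L: "L > 0" and f: "\<And>x. (f has_vector_derivative f' x) (at x)" "continuous_on UNIV f'"
  shows "has_weak_deriv L f f'"
  unfolding has_weak_deriv_def
proof (intro conjI allI impI)
  have "continuous_on UNIV f"
    by (rule continuous_on_vector_derivative) (rule has_vector_derivative_at_within, rule f)
  then show fL: "f \<in> L2 L" by (rule L2_continuous)
  show f'L: "f' \<in> L2 L" by (rule L2_continuous) fact
  fix \<phi> assume \<phi>: "test_fun L \<phi>"
  let ?d = "\<lambda>x. vector_derivative \<phi> (at x)"
  have s: "smooth \<phi>" by (rule test_fun_smooth) fact
  have "(LINT x|interval_measure L. f x * ?d x + f' x * \<phi> x) = 0"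
  proof (rule integral_deriv_eq_0[OF L])
    show "((\<lambda>x. f x * \<phi> x) has_vector_derivative f x * ?d x + f' x * \<phi> x) (at x)" for x
      by (intro has_vector_derivative_mult f smooth_has_derivative s)
    show "continuous_on UNIV (\<lambda>x. f x * ?d x + f' x * \<phi> x)"
      by (intro continuous_intros f smooth_continuous_derivative[OF s] smooth_continuous[OF s])
        fact
  qed (use test_fun_zero[OF \<phi>] in auto)
  moreover have "(LINT x|interval_measure L. f x * ?d x + f' x * \<phi> x) =
      (LINT x|interval_measure L. f x * ?d x) + (LINT x|interval_measure L. f' x * \<phi> x)"
    by (intro Bochner_Integration.integral_add integrable_mult_L2 fL f'L
          test_fun_deriv_L2[OF \<phi>] test_fun_L2[OF \<phi>])
  ultimately show "(LINT x|interval_measure L. f x * ?d x) = - (LINT x|interval_measure L. f' x * \<phi> x)"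
    by (simp add: eq_neg_iff_add_eq_0)
qed

lemma has_weak_deriv_lincomb:
  assumes "has_weak_deriv L f f'" "has_weak_deriv L g g'"
  shows "has_weak_deriv L (\<lambda>x. f x + c * g x) (\<lambda>x. f' x + c * g' x)"
  unfolding has_weak_deriv_def
proof (intro conjI allI impI)
  have L2: "f \<in> L2 L" "g \<in> L2 L" "f' \<in> L2 L" "g' \<in> L2 L"
    using assms by (auto simp: has_weak_deriv_def)
  show "(\<lambda>x. f x + c * g x) \<in> L2 L" "(\<lambda>x. f' x + c * g' x) \<in> L2 L"
    by (intro L2_add L2_scale L2)+
  fix \<phi> assume \<phi>: "test_fun L \<phi>"
  let ?d = "\<lambda>x. vector_derivative \<phi> (at x)"
  note t = test_fun_deriv_L2[OF \<phi>] test_fun_L2[OF \<phi>]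
  have expand: "(LINT x|interval_measure L. (u x + c * v x) * w x) =
      (LINT x|interval_measure L. u x * w x) + c * (LINT x|interval_measure L. v x * w x)"
    if "u \<in> L2 L" "v \<in> L2 L" "w \<in> L2 L" for u v w
    using that integrable_mult_L2[of u L w] integrable_mult_L2[of v L w]
    by (simp add: distrib_right mult.assoc)
  show "(LINT x|interval_measure L. (f x + c * g x) * ?d x) =
      - (LINT x|interval_measure L. (f' x + c * g' x) * \<phi> x)"
    using assms \<phi> by (simp add: expand L2 t has_weak_deriv_def)
qed

lemma has_weak_deriv_scale:
  assumes "has_weak_deriv L f f'"
  shows "has_weak_deriv L (\<lambda>x. c * f x) (\<lambda>x. c * f' x)"
  \<comment> \<open>\<open>c f = f + (c - 1) f\<close> reduces scaling to linear combinations, here and below.\<close>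
  using has_weak_deriv_lincomb[OF assms assms, of "c - 1"] by (simp add: algebra_simps)

lemma has_weak_deriv_unique:
  assumes "has_weak_deriv L f g" "has_weak_deriv L f h"
  shows "AE x in interval_measure L. g x = h x"
proof -
  have d: "has_weak_deriv L (\<lambda>x. f x + (-1) * f x) (\<lambda>x. g x + (-1) * h x)"
    by (rule has_weak_deriv_lincomb[OF assms])
  have "AE x in interval_measure L. g x + (-1) * h x = 0"
  proof (rule fundamental_lemma)
    show "(\<lambda>x. g x + (-1) * h x) \<in> L2 L"
      using d by (simp add: has_weak_deriv_def)
    show "(LINT x|interval_measure L. (g x + (-1) * h x) * \<phi> x) = 0" if "test_fun L \<phi>" for \<phi>
      using d that by (simp add: has_weak_deriv_def)
  qed
  then show ?thesis by simp
qed

lemma H1_weak_deriv: "f \<in> H1 L \<Longrightarrow> has_weak_deriv L f (weak_deriv L f)"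
  unfolding H1_def weak_deriv_def by (auto intro: someI[of "has_weak_deriv L f"])

lemma weak_deriv_AE:
  assumes "has_weak_deriv L f g"
  shows "AE x in interval_measure L. weak_deriv L f x = g x"
  using has_weak_deriv_unique[OF H1_weak_deriv assms] assms by (auto simp: H1_def)

lemma has_weak_deriv_cong:
  assumes "f \<in> L2 L" "h \<in> L2 L" "AE x in interval_measure L. f x = h x"
  shows "has_weak_deriv L f g \<longleftrightarrow> has_weak_deriv L h g"
proof -
  have "(LINT x|interval_measure L. f x * vector_derivative \<phi> (at x)) =
      (LINT x|interval_measure L. h x * vector_derivative \<phi> (at x))" if "test_fun L \<phi>" for \<phi>
  proof (rule integral_cong_AE)
    note [measurable] = assms(1,2)[THEN L2_measurable] test_fun_deriv_L2[OF that, THEN L2_measurable]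
    show "(\<lambda>x. f x * vector_derivative \<phi> (at x)) \<in> borel_measurable (interval_measure L)"
      "(\<lambda>x. h x * vector_derivative \<phi> (at x)) \<in> borel_measurable (interval_measure L)"
      by measurable
    show "AE x in interval_measure L. f x * vector_derivative \<phi> (at x) = h x * vector_derivative \<phi> (at x)"
      using assms(3) by eventually_elim simp
  qed
  then show ?thesis
    using assms(1,2) unfolding has_weak_deriv_def by simp
qed

text \<open>
  Equality everywhere, not just almost everywhere: the two functions have the same set of weak
  derivatives to choose from.
\<close>

lemma weak_deriv_cong:
  assumes "f \<in> L2 L" "h \<in> L2 L" "AE x in interval_measure L. f x = h x"
  shows "weak_deriv L f = weak_deriv L h"
  using has_weak_deriv_cong[OF assms] by (simp add: weak_deriv_def)

lemma H1_D:
  assumes "f \<in> H1 L"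
  shows H1_L2: "f \<in> L2 L" and weak_deriv_L2: "weak_deriv L f \<in> L2 L"
  using H1_weak_deriv[OF assms] by (auto simp: has_weak_deriv_def)

lemma H1_lincomb:
  assumes "f \<in> H1 L" "g \<in> H1 L"
  shows "(\<lambda>x. f x + c * g x) \<in> H1 L"
    and weak_deriv_lincomb: "AE x in interval_measure L.
      weak_deriv L (\<lambda>x. f x + c * g x) x = weak_deriv L f x + c * weak_deriv L g x"
proof -
  note d = has_weak_deriv_lincomb[OF H1_weak_deriv[OF assms(1)] H1_weak_deriv[OF assms(2)], of c]
  show "(\<lambda>x. f x + c * g x) \<in> H1 L"
    using d by (auto simp: H1_def)
  show "AE x in interval_measure L.
      weak_deriv L (\<lambda>x. f x + c * g x) x = weak_deriv L f x + c * weak_deriv L g x"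
    by (rule weak_deriv_AE[OF d])
qed

lemma weak_deriv_scale:
  assumes "f \<in> H1 L"
  shows "AE x in interval_measure L. weak_deriv L (\<lambda>x. c * f x) x = c * weak_deriv L f x"
  by (rule weak_deriv_AE[OF has_weak_deriv_scale[OF H1_weak_deriv[OF assms]]])

lemma H1_norm_eq: "H1_norm L f = norm (L2_norm L f, L2_norm L (weak_deriv L f))"
  by (simp add: H1_norm_def norm_Pair)

lemma L2_norm_lincomb:
  assumes "f \<in> L2 L" "g \<in> L2 L"
  shows "L2_norm L (\<lambda>x. f x + c * g x) \<le> L2_norm L f + cmod c * L2_norm L g"
proof -
  have "norm2 (interval_measure L) (\<lambda>x. c * g x) = cmod c * norm2 (interval_measure L) g"
    by (rule norm2_norm_scale) (auto simp: norm_mult)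
  then show ?thesis
    using norm2_triangle[of "interval_measure L" f "\<lambda>x. c * g x"] assms L2_scale[of g L c]
    by (simp add: L2_norm_eq L2_iff)
qed

lemma L2_norm_nonneg: "L2_norm L f \<ge> 0"
  by (simp add: L2_norm_def)

lemma L2_norm_cong:
  assumes "f \<in> L2 L" "g \<in> L2 L" "AE x in interval_measure L. f x = g x"
  shows "L2_norm L f = L2_norm L g"
  unfolding L2_norm_eq using assms by (intro norm2_cong_AE L2_measurable)

lemma H1_norm_lincomb:
  assumes f: "f \<in> H1 L" and g: "g \<in> H1 L"
  shows "H1_norm L (\<lambda>x. f x + c * g x) \<le> H1_norm L f + cmod c * H1_norm L g"
proof -
  let ?f' = "weak_deriv L f" and ?g' = "weak_deriv L g"
  have *: "L2_norm L (weak_deriv L (\<lambda>x. f x + c * g x)) = L2_norm L (\<lambda>x. ?f' x + c * ?g' x)"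
    by (intro L2_norm_cong weak_deriv_L2 H1_lincomb L2_add L2_scale weak_deriv_lincomb f g)
  have "H1_norm L (\<lambda>x. f x + c * g x) \<le>
      norm (L2_norm L f + cmod c * L2_norm L g, L2_norm L ?f' + cmod c * L2_norm L ?g')"
    unfolding H1_norm_eq * norm_Pair using L2_norm_lincomb[of f L g c] L2_norm_lincomb[of ?f' L ?g' c]
      H1_D[OF f] H1_D[OF g] L2_norm_nonneg
    by (intro real_sqrt_le_mono add_mono power_mono) (auto simp: abs_of_nonneg)
  also have "\<dots> = norm ((L2_norm L f, L2_norm L ?f') + cmod c *\<^sub>R (L2_norm L g, L2_norm L ?g'))"
    by simp
  also have "\<dots> \<le> H1_norm L f + cmod c * H1_norm L g"
    unfolding H1_norm_eq by (rule order_trans[OF norm_triangle_ineq]) (simp only: norm_scaleR abs_norm_cancel order_refl)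
  finally show ?thesis .
qed

lemma test_fun_lincomb:
  assumes "test_fun L \<phi>" "test_fun L \<psi>"
  shows "test_fun L (\<lambda>x. \<phi> x + c * \<psi> x)"
proof -
  have "closure {x. \<phi> x + c * \<psi> x \<noteq> 0} \<subseteq> closure ({x. \<phi> x \<noteq> 0} \<union> {x. \<psi> x \<noteq> 0})"
    by (rule closure_mono) auto
  then show ?thesis
    using assms by (auto simp: test_fun_iff closure_Un intro: smooth_lincomb)
qed

lemma smooth_has_weak_deriv:
  assumes "L > 0" "smooth f"
  shows "has_weak_deriv L f (\<lambda>x. vector_derivative f (at x))"
  by (rule has_weak_deriv_C1[OF assms(1) smooth_has_derivative smooth_continuous_derivative]) fact+

lemma smooth_H1: "L > 0 \<Longrightarrow> smooth f \<Longrightarrow> f \<in> H1 L"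
  using smooth_has_weak_deriv by (auto simp: H1_def)

lemma H10_H1: "f \<in> H10 L \<Longrightarrow> f \<in> H1 L"
  by (simp add: H10_def)

lemma H10_lincomb:
  assumes L: "L > 0" and f: "f \<in> H10 L" and g: "g \<in> H10 L"
  shows "(\<lambda>x. f x + c * g x) \<in> H10 L"
  unfolding H10_def
proof (intro CollectI conjI allI impI)
  note f1 = H10_H1[OF f] and g1 = H10_H1[OF g]
  show "(\<lambda>x. f x + c * g x) \<in> H1 L" by (rule H1_lincomb[OF f1 g1])
  fix e :: real assume e: "e > 0"
  have "e / 2 > 0" "e / (2 * (cmod c + 1)) > 0"
    using e by (auto intro!: divide_pos_pos simp: add_nonneg_pos)
  then obtain \<phi> \<psi> where \<phi>: "test_fun L \<phi>" "H1_norm L (\<lambda>x. f x - \<phi> x) < e / 2"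
    and \<psi>: "test_fun L \<psi>" "H1_norm L (\<lambda>x. g x - \<psi> x) < e / (2 * (cmod c + 1))"
    using f g unfolding H10_def by blast
  have diff: "(\<lambda>x. u x - \<theta> x) \<in> H1 L" if "u \<in> H1 L" "test_fun L \<theta>" for u \<theta>
    using H1_lincomb(1)[OF that(1) smooth_H1[OF L test_fun_smooth[OF that(2)]], of "-1"] by simp
  have "H1_norm L (\<lambda>x. (f x + c * g x) - (\<phi> x + c * \<psi> x)) =
      H1_norm L (\<lambda>x. (f x - \<phi> x) + c * (g x - \<psi> x))"
    by (simp add: algebra_simps)
  also have "\<dots> \<le> H1_norm L (\<lambda>x. f x - \<phi> x) + cmod c * H1_norm L (\<lambda>x. g x - \<psi> x)"
    by (intro H1_norm_lincomb diff f1 g1 \<phi> \<psi>)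
  also have "\<dots> < e / 2 + e / 2"
  proof (rule add_less_le_mono[OF \<phi>(2)])
    have "cmod c * H1_norm L (\<lambda>x. g x - \<psi> x) \<le> cmod c * (e / (2 * (cmod c + 1)))"
      using \<psi> by (intro mult_left_mono) auto
    also have "\<dots> = (cmod c / (cmod c + 1)) * (e / 2)" by simp
    also have "\<dots> \<le> 1 * (e / 2)"
      using e by (intro mult_right_mono) (auto simp: add_nonneg_pos)
    finally show "cmod c * H1_norm L (\<lambda>x. g x - \<psi> x) \<le> e / 2" by simp
  qed
  finally have "H1_norm L (\<lambda>x. (f x + c * g x) - (\<phi> x + c * \<psi> x)) < e" by simp
  then show "\<exists>\<phi>. test_fun L \<phi> \<and> H1_norm L (\<lambda>x. f x + c * g x - \<phi> x) < e"
    using test_fun_lincomb[OF \<phi>(1) \<psi>(1)] by blast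
qed

lemma H10_scale:
  assumes "L > 0" "f \<in> H10 L"
  shows "(\<lambda>x. c * f x) \<in> H10 L"
  using H10_lincomb[OF assms assms(2), of "c - 1"] by (simp add: algebra_simps)

section \<open>Sines that vanish at both ends belong to H10\<close>

lemma L2_norm_tendsto_0:
  fixes h :: "nat \<Rightarrow> real \<Rightarrow> complex"
  assumes meas: "\<And>n. h n \<in> borel_measurable (interval_measure L)"
    and bound: "\<And>n x. x \<in> {0<..<L} \<Longrightarrow> cmod (h n x) \<le> B"
    and lim: "\<And>x. x \<in> {0<..<L} \<Longrightarrow> (\<lambda>n. h n x) \<longlonglongrightarrow> 0"
  shows "(\<lambda>n. L2_norm L (h n)) \<longlonglongrightarrow> 0"
proof -
  interpret finite_measure "interval_measure L" by (rule finite_interval_measure)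
  note [measurable] = meas
  have "(\<lambda>n. LINT x|interval_measure L. (cmod (h n x))\<^sup>2) \<longlonglongrightarrow> (LINT x|interval_measure L. 0)"
  proof (rule integral_dominated_convergence)
    show "integrable (interval_measure L) (\<lambda>x. B\<^sup>2)" by simp
    show "AE x in interval_measure L. (\<lambda>n. (cmod (h n x))\<^sup>2) \<longlonglongrightarrow> 0"
      by (rule AE_I2) (auto intro!: tendsto_eq_intros lim)
    show "AE x in interval_measure L. norm ((cmod (h n x))\<^sup>2) \<le> B\<^sup>2" for n
      by (rule AE_I2) (auto intro!: power_mono bound)
  qed measurable
  then have "(\<lambda>n. sqrt (LINT x|interval_measure L. (cmod (h n x))\<^sup>2)) \<longlonglongrightarrow> sqrt (LINT x|interval_measure L. 0)"
    by (rule tendsto_real_sqrt)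
  then show ?thesis by (simp add: L2_norm_def)
qed

definition flat_slope :: "real \<Rightarrow> real \<Rightarrow> real" where
  "flat_slope s x = (if x > 0 then s / x\<^sup>2 * exp (- s / x) else 0)"

lemma flat_1_deriv:
  assumes "s > 0"
  shows "(flat 1 s has_real_derivative flat_slope s x) (at x)"
proof -
  have "flat ([:0, 0, 1:] * (smult s 1 - pderiv 1)) s x = flat_slope s x"
    by (simp add: flat_def flat_slope_def power2_eq_square)
  then show ?thesis using flat_has_derivative[OF assms, of 1 x] by metis
qed

lemma flat_slope_nonneg: "s > 0 \<Longrightarrow> flat_slope s x \<ge> 0"
  by (simp add: flat_slope_def)

text \<open>
  With \<open>r = s / (x - s)\<close> the left-hand side is \<open>(r + r\<^sup>2) exp (- r)\<close>. The point is that the bound is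
  uniform in \<open>s\<close>: the derivative of the cut-off function is of order \<open>1 / s\<close>, but only where \<open>x\<close> is of
  order \<open>s\<close>.
\<close>

lemma flat_slope_shift_bound:
  assumes "s > 0" "x > 0"
  shows "x * flat_slope s (x - s) \<le> 2"
proof (cases "x > s")
  case True
  define r where "r = s / (x - s)"
  have r: "r \<ge> 0" using assms True by (simp add: r_def)
  have "r + r\<^sup>2 = x * (s / (x - s)\<^sup>2)"
  proof -
    define t where "t = x - s"
    have "t > 0" "x = t + s" using True by (auto simp: t_def)
    then show ?thesis
      by (simp add: r_def add_divide_distrib power2_eq_square distrib_right)
  qed
  then have "x * flat_slope s (x - s) = (r + r\<^sup>2) * exp (- r)"
    using True by (simp add: flat_slope_def r_def)
  also have "\<dots> \<le> (2 * exp r) * exp (- r)"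
    using exp_lower_Taylor_quadratic[OF r] r by (intro mult_right_mono) auto
  also have "\<dots> = 2" by (simp add: exp_minus)
  finally show ?thesis .
qed (simp add: flat_slope_def)

lemma
  assumes "s \<longlonglongrightarrow> 0" "x > 0"
  shows flat_shift_tendsto: "(\<lambda>n. flat 1 (s n) (x - s n)) \<longlonglongrightarrow> 1"
    and flat_slope_shift_tendsto: "(\<lambda>n. flat_slope (s n) (x - s n)) \<longlonglongrightarrow> 0"
proof -
  have ev: "\<forall>\<^sub>F n in sequentially. x - s n > 0"
    using order_tendstoD(2)[OF assms] by eventually_elim simp
  have "(\<lambda>n. exp (- s n / (x - s n))) \<longlonglongrightarrow> 1"
    using assms by (auto intro!: tendsto_eq_intros)
  then show "(\<lambda>n. flat 1 (s n) (x - s n)) \<longlonglongrightarrow> 1"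
    by (rule Lim_transform_eventually) (use ev in \<open>eventually_elim, simp add: flat_def\<close>)
  have "(\<lambda>n. s n / (x - s n)\<^sup>2 * exp (- s n / (x - s n))) \<longlonglongrightarrow> 0"
    using assms by (auto intro!: tendsto_eq_intros)
  then show "(\<lambda>n. flat_slope (s n) (x - s n)) \<longlonglongrightarrow> 0"
    by (rule Lim_transform_eventually) (use ev in \<open>eventually_elim, simp add: flat_slope_def\<close>)
qed

lemma abs_sin_le_dist_end:
  fixes k L x :: real
  assumes "k > 0" "sin (k * L) = 0" "x \<le> L"
  shows "\<bar>sin (k * x)\<bar> \<le> k * (L - x)"
proof -
  have "sin (k * x) = sin (k * L - k * (L - x))" by (simp add: algebra_simps)
  also have "\<dots> = - cos (k * L) * sin (k * (L - x))"
    by (simp add: sin_diff assms(2))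
  finally have "\<bar>sin (k * x)\<bar> = \<bar>cos (k * L)\<bar> * \<bar>sin (k * (L - x))\<bar>"
    by (simp add: abs_mult)
  also have "\<dots> \<le> 1 * \<bar>k * (L - x)\<bar>"
    by (intro mult_mono abs_sin_x_le_abs_x) auto
  also have "\<dots> = k * (L - x)"
    using assms by (subst abs_of_nonneg) auto
  finally show ?thesis .
qed

text \<open>
  The approximating test functions are \<open>\<phi> n = f \<eta>\<close> for \<open>f = sin (k x)\<close> and a cut-off function \<open>\<eta>\<close> on
  \<open>(s n, L - s n)\<close>, where \<open>s n\<close> tends to 0 and is also the steepness parameter. On \<open>(0, L)\<close> both
  \<open>f - \<phi> n\<close> and its derivative \<open>h n\<close> tend to 0 pointwise. They are bounded uniformly in \<open>n\<close>, because
  \<open>f\<close> is at most \<open>k\<close> times the distance to either end, which compensates the steepness of \<open>\<eta>\<close> there.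
\<close>

lemma sin_H10:
  assumes L: "L > 0" and k: "k > 0" and kL: "sin (k * L) = 0"
  shows "(\<lambda>x. of_real (sin (k * x))) \<in> H10 L"
proof -
  define f :: "real \<Rightarrow> complex" where "f x = of_real (sin (k * x))" for x
  define s where "s n = inverse (real (Suc n))" for n
  have s: "s n > 0" for n by (simp add: s_def)
  have s0: "s \<longlonglongrightarrow> 0" unfolding s_def by (rule LIMSEQ_inverse_real_of_nat)
  define \<eta> where "\<eta> n = bump (s n) (s n) (L - s n)" for n
  define \<phi> :: "nat \<Rightarrow> real \<Rightarrow> complex" where "\<phi> n x = f x * of_real (\<eta> n x)" for n x
  define h where "h n x = k * cos (k * x) * (1 - \<eta> n x) -
     sin (k * x) * (flat_slope (s n) (x - s n) * flat 1 (s n) (L - x - s n)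
       - flat 1 (s n) (x - s n) * flat_slope (s n) (L - x - s n))" for n x
  have test: "test_fun L (\<phi> n)" for n
    unfolding \<phi>_def \<eta>_def f_def
    by (rule test_fun_mult_bump) (use s in \<open>auto intro: elementary.sin\<close>)
  have smooth_f: "smooth f"
    unfolding f_def by (intro smooth_elementary elementary.sin)
  have smooth_diff: "smooth (\<lambda>x. f x - \<phi> n x)" for n
    using smooth_lincomb[OF smooth_f test_fun_smooth[OF test], of "-1"] by simp
  have deriv: "((\<lambda>x. f x - \<phi> n x) has_vector_derivative of_real (h n x)) (at x)" for n x
  proof -
    have *: "((\<lambda>x. flat 1 (s n) (x - s n)) has_real_derivative flat_slope (s n) (x - s n) * 1) (at x)"
      by (rule DERIV_chain'[OF _ flat_1_deriv[OF s], of "\<lambda>x. x - s n"]) (auto intro!: derivative_eq_intros)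
    have **: "((\<lambda>x. flat 1 (s n) (L - s n - x)) has_real_derivative flat_slope (s n) (L - s n - x) * (-1)) (at x)"
      by (rule DERIV_chain'[OF _ flat_1_deriv[OF s], of "\<lambda>x. L - s n - x"]) (auto intro!: derivative_eq_intros)
    have "((\<lambda>x. sin (k * x) - sin (k * x) * \<eta> n x) has_real_derivative h n x) (at x)"
      unfolding \<eta>_def bump_def h_def
      by (rule derivative_eq_intros * ** refl)+ (simp add: algebra_simps)
    from has_vector_derivative_of_real_field[OF this]
    show ?thesis by (simp add: f_def \<phi>_def)
  qed
  have vd: "vector_derivative (\<lambda>x. f x - \<phi> n x) (at x) = of_real (h n x)" for n x
    by (rule vector_derivative_at[OF deriv])
  have weak: "has_weak_deriv L (\<lambda>x. f x - \<phi> n x) (\<lambda>x. of_real (h n x))" for n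
    using smooth_has_weak_deriv[OF L smooth_diff] by (simp add: vd)
  have \<eta>: "0 \<le> \<eta> n x" "\<eta> n x \<le> 1" for n x
    using bump_bounds[OF s] by (auto simp: \<eta>_def)
  have \<eta>_lim: "(\<lambda>n. \<eta> n x) \<longlonglongrightarrow> 1" if "x \<in> {0<..<L}" for x
    using tendsto_mult[OF flat_shift_tendsto[OF s0, of x] flat_shift_tendsto[OF s0, of "L - x"]] that
    by (simp add: \<eta>_def bump_def algebra_simps)
  have L2: "(\<lambda>x. f x - \<phi> n x) \<in> L2 L" "(\<lambda>x. of_real (h n x)) \<in> L2 L" for n
    using weak by (auto simp: has_weak_deriv_def)
  have h_bound: "\<bar>h n x\<bar> \<le> 5 * k" if x: "x \<in> {0<..<L}" for n x
  proof -
    have 1: "\<bar>k * cos (k * x) * (1 - \<eta> n x)\<bar> \<le> k * 1 * 1"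
      unfolding abs_mult using k \<eta>[of n x] by (intro mult_mono) auto
    have fl: "0 \<le> flat 1 (s n) y" "flat 1 (s n) y \<le> 1" for y
      using flat_1_bounds[OF s] by auto
    note fl' = flat_slope_nonneg[OF s]
    have "\<bar>sin (k * x)\<bar> * (flat_slope (s n) (x - s n) * flat 1 (s n) (L - x - s n))
        \<le> (k * x) * (flat_slope (s n) (x - s n) * 1)"
      using x k abs_sin_x_le_abs_x[of "k * x"] fl fl' by (intro mult_mono) auto
    also have "\<dots> \<le> k * 2"
      using flat_slope_shift_bound[OF s, of x n] x k by simp
    finally have 2: "\<bar>sin (k * x)\<bar> * (flat_slope (s n) (x - s n) * flat 1 (s n) (L - x - s n)) \<le> 2 * k"
      by simp
    have "\<bar>sin (k * x)\<bar> * (flat 1 (s n) (x - s n) * flat_slope (s n) (L - x - s n))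
        \<le> (k * (L - x)) * (1 * flat_slope (s n) (L - x - s n))"
      using x k abs_sin_le_dist_end[OF k kL, of x] fl fl' by (intro mult_mono) auto
    also have "\<dots> \<le> k * 2"
      using flat_slope_shift_bound[OF s, of "L - x" n] x k by simp
    finally have 3: "\<bar>sin (k * x)\<bar> * (flat 1 (s n) (x - s n) * flat_slope (s n) (L - x - s n)) \<le> 2 * k"
      by simp
    have "\<bar>sin (k * x) * (flat_slope (s n) (x - s n) * flat 1 (s n) (L - x - s n)
        - flat 1 (s n) (x - s n) * flat_slope (s n) (L - x - s n))\<bar> \<le>
      \<bar>sin (k * x)\<bar> * (flat_slope (s n) (x - s n) * flat 1 (s n) (L - x - s n)) +
      \<bar>sin (k * x)\<bar> * (flat 1 (s n) (x - s n) * flat_slope (s n) (L - x - s n))"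
      unfolding abs_mult distrib_left[symmetric]
      using fl fl' by (intro mult_left_mono order_trans[OF abs_triangle_ineq4]) (auto simp: abs_mult)
    with 1 2 3 show ?thesis unfolding h_def by linarith
  qed
  have h_lim: "(\<lambda>n. h n x) \<longlonglongrightarrow> 0" if x: "x \<in> {0<..<L}" for x
  proof -
    have "(\<lambda>n. h n x) \<longlonglongrightarrow> k * cos (k * x) * (1 - 1) - sin (k * x) * (0 * 1 - 1 * 0)"
      unfolding h_def
      by (intro tendsto_intros \<eta>_lim[OF x] flat_shift_tendsto flat_slope_shift_tendsto s0) (use x in auto)
    then show ?thesis by simp
  qed
  have "(\<lambda>n. L2_norm L (\<lambda>x. f x - \<phi> n x)) \<longlonglongrightarrow> 0"
  proof (rule L2_norm_tendsto_0)
    show "(\<lambda>x. f x - \<phi> n x) \<in> borel_measurable (interval_measure L)" for n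
      by (rule L2_measurable[OF L2(1)])
    have eq: "f x - \<phi> n x = of_real (sin (k * x) * (1 - \<eta> n x))" for n x
      by (simp add: f_def \<phi>_def algebra_simps)
    show "cmod (f x - \<phi> n x) \<le> 1" for n x
      unfolding eq norm_of_real abs_mult using \<eta>[of n x] by (intro mult_le_one) auto
    show "(\<lambda>n. f x - \<phi> n x) \<longlonglongrightarrow> 0" if "x \<in> {0<..<L}" for x
      unfolding \<phi>_def using \<eta>_lim[OF that] by (auto intro!: tendsto_eq_intros)
  qed
  moreover have "(\<lambda>n. L2_norm L (\<lambda>x. of_real (h n x))) \<longlonglongrightarrow> 0"
  proof (rule L2_norm_tendsto_0)
    show "(\<lambda>x. complex_of_real (h n x)) \<in> borel_measurable (interval_measure L)" for n
      by (rule L2_measurable[OF L2(2)])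
    show "cmod (complex_of_real (h n x)) \<le> 5 * k" if "x \<in> {0<..<L}" for n x
      using h_bound[OF that] by simp
    show "(\<lambda>n. complex_of_real (h n x)) \<longlonglongrightarrow> 0" if "x \<in> {0<..<L}" for x
      using tendsto_of_real[OF h_lim[OF that]] by simp
  qed
  moreover have "L2_norm L (weak_deriv L (\<lambda>x. f x - \<phi> n x)) = L2_norm L (\<lambda>x. of_real (h n x))" for n
    using weak by (intro L2_norm_cong weak_deriv_L2 L2 weak_deriv_AE) (auto simp: H1_def)
  ultimately have "(\<lambda>n. H1_norm L (\<lambda>x. f x - \<phi> n x)) \<longlonglongrightarrow> 0"
    unfolding H1_norm_def by (auto intro!: tendsto_eq_intros)
  then have "\<exists>n. H1_norm L (\<lambda>x. f x - \<phi> n x) < e" if "e > 0" for e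
    using order_tendstoD(2)[OF _ that] eventually_happens trivial_limit_sequentially by blast
  then have "\<exists>\<phi>. test_fun L \<phi> \<and> H1_norm L (\<lambda>x. f x - \<phi> x) < e" if "e > 0" for e
    using test that by blast
  then have "f \<in> H10 L"
    using smooth_H1[OF L smooth_f] by (simp add: H10_def)
  then show ?thesis by (simp add: f_def[abs_def])
qed

section \<open>The energy norm\<close>

text \<open>
  The energy norm is a seminorm on this space, which imposes no boundary conditions.
\<close>

definition finite_energy :: "real \<Rightarrow> state set" where
  "finite_energy L = H1 L \<times> L2 L \<times> H1 L \<times> L2 L"

text \<open>
  The vector-valued function whose norm in \<open>L2\<close> is the energy norm, so that Minkowski's inequality for functions
  with values in a normed space applies.
\<close>

fun energy_density :: "real \<Rightarrow> real \<Rightarrow> state \<Rightarrow> real \<Rightarrow> complex \<times> complex \<times> complex \<times> complex" where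
  "energy_density L a (u, v, y, z) x =
     (v x, of_real (sqrt a) * weak_deriv L u x, z x, weak_deriv L y x)"

lemma energy_norm_eq:
  assumes "a > 0"
  shows "energy_norm L a U = norm2 (interval_measure L) (energy_density L a U)"
  using assms by (cases U) (simp add: norm2_def norm_Pair norm_mult power_mult_distrib add.assoc)

lemma sq_integrable_Pair:
  assumes "sq_integrable M f" "sq_integrable M g"
  shows "sq_integrable M (\<lambda>x. (f x, g x))"
  using assms by (auto simp: sq_integrable_def norm_Pair)

lemma sq_integrable_energy_density:
  assumes "U \<in> finite_energy L"
  shows "sq_integrable (interval_measure L) (energy_density L a U)"
proof -
  obtain u v y z where U: "U = (u, v, y, z)" by (metis prod_cases4)
  have "u \<in> H1 L" "v \<in> L2 L" "y \<in> H1 L" "z \<in> L2 L"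
    using assms by (auto simp: U finite_energy_def)
  then have "sq_integrable (interval_measure L)
      (\<lambda>x. (v x, of_real (sqrt a) * weak_deriv L u x, z x, weak_deriv L y x))"
    by (intro sq_integrable_Pair) (auto simp: L2_iff[symmetric] intro!: L2_scale weak_deriv_L2)
  moreover have "energy_density L a U =
      (\<lambda>x. (v x, of_real (sqrt a) * weak_deriv L u x, z x, weak_deriv L y x))"
    by (simp add: U fun_eq_iff)
  ultimately show ?thesis by simp
qed

lemma sq_integrable_measurable: "sq_integrable M f \<Longrightarrow> f \<in> borel_measurable M"
  by (simp add: sq_integrable_def)

lemma finite_energy_lincomb:
  assumes "U \<in> finite_energy L" "V \<in> finite_energy L"
  shows "state_add U (state_scale k V) \<in> finite_energy L"
  using assms by (cases U; cases V) (auto simp: finite_energy_def intro!: H1_lincomb L2_add L2_scale)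

lemma state_scale_eq_lincomb: "state_scale k U = state_add U (state_scale (k - 1) U)"
  by (cases U) (simp add: algebra_simps)

lemma finite_energy_scale:
  assumes "U \<in> finite_energy L"
  shows "state_scale k U \<in> finite_energy L"
  by (subst state_scale_eq_lincomb) (rule finite_energy_lincomb[OF assms assms])

lemma energy_space_lincomb:
  assumes "L > 0" "U \<in> energy_space L" "V \<in> energy_space L"
  shows "state_add U (state_scale k V) \<in> energy_space L"
  using assms by (cases U; cases V) (auto simp: energy_space_def intro!: H10_lincomb L2_add L2_scale)

lemma energy_space_scale:
  assumes "L > 0" "U \<in> energy_space L"
  shows "state_scale k U \<in> energy_space L"
  by (subst state_scale_eq_lincomb) (rule energy_space_lincomb[OF assms assms(2)])

lemma energy_space_finite_energy: "U \<in> energy_space L \<Longrightarrow> U \<in> finite_energy L"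
  by (auto simp: energy_space_def finite_energy_def H10_H1)

text \<open>
  Complex multiples in the fourfold product, which as a type is only a real vector space.
\<close>

fun scale4 :: "complex \<Rightarrow> complex \<times> complex \<times> complex \<times> complex \<Rightarrow> complex \<times> complex \<times> complex \<times> complex" where
  "scale4 k (p, q, r, s) = (k * p, k * q, k * r, k * s)"

lemma norm_scale4: "norm (scale4 k w) = cmod k * norm w"
proof (cases w)
  case (fields p q r s)
  have "norm (scale4 k w) = sqrt ((cmod k)\<^sup>2 * ((cmod p)\<^sup>2 + ((cmod q)\<^sup>2 + ((cmod r)\<^sup>2 + (cmod s)\<^sup>2))))"
    by (simp add: fields norm_Pair norm_mult power_mult_distrib distrib_left)
  then show ?thesis
    by (simp add: fields norm_Pair real_sqrt_mult)
qed

lemma energy_density_lincomb: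
  assumes "U \<in> finite_energy L" "V \<in> finite_energy L"
  shows "AE x in interval_measure L. energy_density L a (state_add U (state_scale k V)) x =
    energy_density L a U x + scale4 k (energy_density L a V x)"
proof -
  obtain u v y z u' v' y' z' where UV: "U = (u, v, y, z)" "V = (u', v', y', z')"
    by (metis prod_cases4)
  then have H: "u \<in> H1 L" "u' \<in> H1 L" "y \<in> H1 L" "y' \<in> H1 L"
    using assms by (auto simp: finite_energy_def)
  from weak_deriv_lincomb[OF H(1,2), of k] weak_deriv_lincomb[OF H(3,4), of k]
  show ?thesis by eventually_elim (simp add: UV algebra_simps)
qed

lemma sq_integrable_scale4:
  assumes "U \<in> finite_energy L"
  shows "sq_integrable (interval_measure L) (\<lambda>x. scale4 k (energy_density L a U x))"
proof -
  obtain u v y z where U: "U = (u, v, y, z)" by (metis prod_cases4)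
  have "u \<in> H1 L" "v \<in> L2 L" "y \<in> H1 L" "z \<in> L2 L"
    using assms by (auto simp: U finite_energy_def)
  then have "sq_integrable (interval_measure L)
      (\<lambda>x. (k * v x, k * (of_real (sqrt a) * weak_deriv L u x), k * z x, k * weak_deriv L y x))"
    by (intro sq_integrable_Pair) (auto simp: L2_iff[symmetric] intro!: L2_scale weak_deriv_L2)
  then show ?thesis by (simp add: U)
qed

lemma energy_norm_lincomb:
  assumes a: "a > 0" and UV: "U \<in> finite_energy L" "V \<in> finite_energy L"
  shows "energy_norm L a (state_add U (state_scale k V)) \<le> energy_norm L a U + cmod k * energy_norm L a V"
proof -
  note s = sq_integrable_energy_density[OF UV(1)] sq_integrable_scale4[OF UV(2), of k]
  have "energy_norm L a (state_add U (state_scale k V)) =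
      norm2 (interval_measure L) (\<lambda>x. energy_density L a U x + scale4 k (energy_density L a V x))"
    unfolding energy_norm_eq[OF a]
    by (intro norm2_cong_AE energy_density_lincomb UV sq_integrable_measurable
          sq_integrable_energy_density finite_energy_lincomb sq_integrable_add s)
  also have "\<dots> \<le> norm2 (interval_measure L) (energy_density L a U) +
      norm2 (interval_measure L) (\<lambda>x. scale4 k (energy_density L a V x))"
    by (rule norm2_triangle[OF s])
  also have "norm2 (interval_measure L) (\<lambda>x. scale4 k (energy_density L a V x)) =
      cmod k * norm2 (interval_measure L) (energy_density L a V)"
    by (rule norm2_norm_scale) (simp_all add: norm_scale4)
  finally show ?thesis by (simp add: energy_norm_eq[OF a])
qed

lemma energy_norm_scale:
  assumes a: "a > 0" and U: "U \<in> finite_energy L"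
  shows "energy_norm L a (state_scale k U) = cmod k * energy_norm L a U"
proof -
  obtain u v y z where UV: "U = (u, v, y, z)" by (metis prod_cases4)
  then have H: "u \<in> H1 L" "y \<in> H1 L"
    using U by (auto simp: finite_energy_def)
  have "AE x in interval_measure L. energy_density L a (state_scale k U) x = scale4 k (energy_density L a U x)"
    using weak_deriv_scale[OF H(1), of k] weak_deriv_scale[OF H(2), of k]
    by eventually_elim (simp add: UV)
  then have "norm2 (interval_measure L) (energy_density L a (state_scale k U)) =
      norm2 (interval_measure L) (\<lambda>x. scale4 k (energy_density L a U x))"
    by (intro norm2_cong_AE sq_integrable_measurable sq_integrable_energy_density
          finite_energy_scale sq_integrable_scale4 U)
  also have "\<dots> = cmod k * norm2 (interval_measure L) (energy_density L a U)"
    by (rule norm2_norm_scale) (simp_all add: norm_scale4)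
  finally show ?thesis by (simp add: energy_norm_eq[OF a])
qed

lemma energy_norm_cong:
  assumes a: "a > 0" and "U \<in> finite_energy L" "V \<in> finite_energy L" "state_eq L U V"
  shows "energy_norm L a U = energy_norm L a V"
proof -
  obtain u v y z u' v' y' z' where UV: "U = (u, v, y, z)" "V = (u', v', y', z')"
    by (metis prod_cases4)
  have ae: "AE x in interval_measure L. u x = u' x \<and> v x = v' x \<and> y x = y' x \<and> z x = z' x"
    using assms(4) by (simp add: UV)
  have "weak_deriv L u = weak_deriv L u'" "weak_deriv L y = weak_deriv L y'"
    using assms(2,3) ae by (auto simp: UV finite_energy_def intro!: weak_deriv_cong H1_L2)
  then have "AE x in interval_measure L. energy_density L a U x = energy_density L a V x"
    using ae by (simp add: UV)
  then show ?thesis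
    unfolding energy_norm_eq[OF a] using assms
    by (intro norm2_cong_AE sq_integrable_measurable sq_integrable_energy_density)
qed

lemma energy_norm_nonneg: "a > 0 \<Longrightarrow> energy_norm L a U \<ge> 0"
  by (simp add: energy_norm_eq norm2_def)

section \<open>Orbits of eigenvectors\<close>

lemma state_diff_scale: "state_diff U (state_scale k V) = state_add U (state_scale (- k) V)"
  by (cases V) (simp add: state_diff_def)

lemma exp_difference_quotient:
  fixes l :: complex
  shows "((\<lambda>h. (exp (l * of_real h) - 1) / of_real h) \<longlongrightarrow> l) (at_right 0)"
proof -
  have "((\<lambda>w. exp (l * w)) has_field_derivative l) (at 0)"
    by (auto intro!: derivative_eq_intros)
  then have "((\<lambda>w. (exp (l * w) - 1) / w) \<longlongrightarrow> l) (at 0)"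
    by (simp add: DERIV_def)
  moreover have "filterlim complex_of_real (at 0) (at_right 0)"
    unfolding filterlim_at
    by (auto intro!: tendsto_eq_intros simp: eventually_at_right_field intro: exI[of _ 1])
  ultimately show ?thesis by (rule filterlim_compose)
qed

text \<open>
  Let \<open>R h = T h U - exp (l h) U\<close>. The generator gives \<open>R h = o(h)\<close>, and the semigroup law gives
  \<open>R ((n + 1) h) = T h (R (n h)) + exp (l n h) R h\<close>. As \<open>T h\<close> is a contraction, \<open>R (n h)\<close> is at most \<open>n\<close>
  times a constant times \<open>R h\<close> in norm. For \<open>h = t / n\<close> this is \<open>t (R h) / h\<close> up to a constant and
  tends to 0 as \<open>n\<close> grows.
\<close>

lemma semigroup_eigenvector:
  assumes L: "L > 0" and a: "a > 0" and T: "contraction_semigroup L a T"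
    and gen: "(U, state_scale l U) \<in> generator_graph L a T" and t: "t > 0"
  shows "energy_norm L a (state_diff (T t U) (state_scale (exp (l * of_real t)) U)) = 0"
proof -
  let ?N = "energy_norm L a"
  define R where "R h = state_diff (T h U) (state_scale (exp (l * of_real h)) U)" for h
  have U: "U \<in> energy_space L"
    using gen by (simp add: generator_graph_def)
  note fe = energy_space_finite_energy
  have TE: "T s V \<in> energy_space L" if "s \<ge> 0" "V \<in> energy_space L" for s V
    using T that by (simp add: contraction_semigroup_def)
  have R: "R h \<in> energy_space L" if "h \<ge> 0" for h
    unfolding R_def state_diff_scale by (intro energy_space_lincomb L TE U that)

  \<comment> \<open>\<open>R h / h\<close> is the defect \<open>D h\<close> of the generator limit minus \<open>q h U\<close>, where \<open>q h\<close> is the defect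
    of the difference quotient of the exponential function; both tend to 0.\<close>
  have small: "((\<lambda>h. ?N (R h) / h) \<longlongrightarrow> 0) (at_right 0)"
  proof -
    define D where "D h = state_diff (state_scale (of_real (1 / h)) (state_diff (T h U) U)) (state_scale l U)" for h
    define q where "q h = (exp (l * of_real h) - 1) / of_real h - l" for h
    have "(q \<longlongrightarrow> 0) (at_right 0)"
      unfolding q_def using tendsto_diff[OF exp_difference_quotient tendsto_const, of l l] by simp
    moreover have "((\<lambda>h. ?N (D h)) \<longlongrightarrow> 0) (at_right 0)"
      using gen by (simp add: D_def generator_graph_def)
    ultimately have lim: "((\<lambda>h. ?N (D h) + cmod (q h) * ?N U) \<longlongrightarrow> 0) (at_right 0)"
      by (auto intro!: tendsto_eq_intros)
    have "?N (R h) / h \<le> ?N (D h) + cmod (q h) * ?N U" if h: "h > 0" for h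
    proof -
      have D: "D h \<in> energy_space L"
        unfolding D_def state_diff_scale using h
        by (auto simp: state_diff_def intro!: energy_space_lincomb energy_space_scale L U TE)
      obtain u v y z where Uc: "U = (u, v, y, z)" by (metis prod_cases4)
      obtain u' v' y' z' where Tc: "T h U = (u', v', y', z')" by (metis prod_cases4)
      have Rq: "R h = state_scale (of_real h) (state_add (D h) (state_scale (- q h) U))"
        unfolding R_def D_def q_def Tc using h by (simp add: Uc state_diff_def fun_eq_iff field_simps)
      have "?N (R h) = h * ?N (state_add (D h) (state_scale (- q h) U))"
        unfolding Rq using h
        by (subst energy_norm_scale[OF a finite_energy_lincomb[OF fe[OF D] fe[OF U]]]) simp
      also have "\<dots> \<le> h * (?N (D h) + cmod (- q h) * ?N U)"
        using h by (intro mult_left_mono energy_norm_lincomb a fe D U) auto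
      finally show ?thesis using h by (simp add: field_simps)
    qed
    then have upper: "\<forall>\<^sub>F h in at_right 0. ?N (R h) / h \<le> ?N (D h) + cmod (q h) * ?N U"
      by (auto simp: eventually_at_right_field intro: exI[of _ 1])
    have lower: "\<forall>\<^sub>F h in at_right 0. 0 \<le> ?N (R h) / h"
      using energy_norm_nonneg[OF a] by (auto simp: eventually_at_right_field intro!: exI[of _ 1])
    show ?thesis by (rule tendsto_sandwich[OF lower upper tendsto_const lim])
  qed

  \<comment> \<open>A bound for \<open>exp (l s)\<close> that is uniform in \<open>s\<close> between 0 and \<open>t\<close>.\<close>
  define M where "M = exp (\<bar>Re l\<bar> * t)"
  have step: "?N (R (real n * h)) \<le> real n * (M * ?N (R h))"
    if h: "h > 0" and n: "real n * h \<le> t" for n h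
    using n
  proof (induction n)
    case 0
    have "state_eq L (T 0 U) U"
      using T U by (simp add: contraction_semigroup_def)
    then have "?N (R 0) = ?N (state_scale 0 U)"
      using R[of 0] U
      by (intro energy_norm_cong a fe energy_space_scale L)
        (cases U; cases "T 0 U"; auto simp: R_def state_diff_def)+
    also have "\<dots> = 0" by (subst energy_norm_scale[OF a fe[OF U]]) simp
    finally show ?case by simp
  next
    case (Suc n)
    define c where "c = exp (l * of_real (real n * h))"
    have nh: "real n * h \<le> t" using Suc.prems h by (simp add: algebra_simps)
    have "cmod c = exp (Re l * (real n * h))" by (simp add: c_def norm_exp_eq_Re)
    also have "\<dots> \<le> M"
      unfolding M_def using nh h by (intro exp_le_cancel_iff[THEN iffD2]) (auto intro!: mult_mono)
    finally have cM: "cmod c \<le> M" .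
    have nh0: "real n * h \<ge> 0" using h by simp
    have E: "T (real n * h) U \<in> energy_space L" "R (real n * h) \<in> energy_space L"
      "R h \<in> energy_space L" "R (real (Suc n) * h) \<in> energy_space L" "T h (R (real n * h)) \<in> energy_space L"
      using h nh0 by (auto intro!: TE R U)
    have "state_eq L (T (h + real n * h) U) (T h (T (real n * h) U))"
      using T U h nh0 unfolding contraction_semigroup_def by (meson less_imp_le)
    moreover have "h + real n * h = real (Suc n) * h" by (simp add: algebra_simps)
    ultimately have e1: "state_eq L (T (real (Suc n) * h) U) (T h (T (real n * h) U))" by simp
    have Rn: "R (real n * h) = state_add (T (real n * h) U) (state_scale (- c) U)"
      by (simp only: R_def state_diff_scale c_def)
    have e2: "state_eq L (T h (R (real n * h))) (state_add (T h (T (real n * h) U)) (T h (state_scale (- c) U)))"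
      unfolding Rn using T U E(1) h energy_space_scale[OF L U, of "- c"]
      unfolding contraction_semigroup_def by (meson less_imp_le)
    have e3: "state_eq L (T h (state_scale (- c) U)) (state_scale (- c) (T h U))"
      using T U h unfolding contraction_semigroup_def by (meson less_imp_le)
    have ex: "exp (l * of_real (real (Suc n) * h)) = c * exp (l * of_real h)"
      by (simp add: c_def exp_add[symmetric] algebra_simps)
    have "state_eq L (R (real (Suc n) * h)) (state_add (T h (R (real n * h))) (state_scale c (R h)))"
    proof -
      obtain u v y z where 1: "U = (u, v, y, z)" by (metis prod_cases4)
      obtain u1 v1 y1 z1 where 2: "T (real (Suc n) * h) U = (u1, v1, y1, z1)" by (metis prod_cases4)
      obtain u2 v2 y2 z2 where 3: "T h (T (real n * h) U) = (u2, v2, y2, z2)" by (metis prod_cases4)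
      obtain u3 v3 y3 z3 where 4: "T h (R (real n * h)) = (u3, v3, y3, z3)" by (metis prod_cases4)
      obtain u4 v4 y4 z4 where 5: "T h (state_scale (- c) U) = (u4, v4, y4, z4)" by (metis prod_cases4)
      obtain u5 v5 y5 z5 where 6: "T h U = (u5, v5, y5, z5)" by (metis prod_cases4)
      have R1: "R (real (Suc n) * h) = state_add (u1, v1, y1, z1) (state_scale (- (c * exp (l * of_real h))) (u, v, y, z))"
        unfolding R_def state_diff_scale ex 2 by (simp only: 1)
      have R2: "R h = state_add (u5, v5, y5, z5) (state_scale (- exp (l * of_real h)) (u, v, y, z))"
        unfolding R_def state_diff_scale 6 by (simp only: 1)
      show ?thesis
        unfolding R1 R2 4 using e1[unfolded 2 3] e2[unfolded 3 4 5] e3[unfolded 5 6]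
        unfolding state_eq.simps state_add.simps state_scale.simps
        by eventually_elim (simp add: algebra_simps)
    qed
    then have "?N (R (real (Suc n) * h)) = ?N (state_add (T h (R (real n * h))) (state_scale c (R h)))"
      by (intro energy_norm_cong a fe E energy_space_lincomb L)
    also have "\<dots> \<le> ?N (T h (R (real n * h))) + cmod c * ?N (R h)"
      by (intro energy_norm_lincomb a fe E)
    also have "\<dots> \<le> ?N (R (real n * h)) + M * ?N (R h)"
      using T E(2) h cM energy_norm_nonneg[OF a]
      by (intro add_mono mult_right_mono) (auto simp: contraction_semigroup_def)
    also have "\<dots> \<le> real n * (M * ?N (R h)) + M * ?N (R h)"
      using Suc.IH[OF nh] by simp
    finally show ?case by (simp add: algebra_simps)
  qed

  have "?N (R t) \<le> M * t * (?N (R (t / real (Suc m))) / (t / real (Suc m)))" for m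
    using step[of "t / real (Suc m)" "Suc m"] t by (simp add: field_simps del: of_nat_Suc)
  moreover have "(\<lambda>m. M * t * (?N (R (t / real (Suc m))) / (t / real (Suc m)))) \<longlonglongrightarrow> M * t * 0"
  proof (intro tendsto_mult_left filterlim_compose[OF small])
    show "filterlim (\<lambda>m. t / real (Suc m)) (at_right 0) sequentially"
      unfolding filterlim_at using t LIMSEQ_Suc[OF lim_const_over_n[of t]] by simp
  qed
  ultimately have "?N (R t) \<le> M * t * 0"
    by (intro LIMSEQ_le_const) auto
  then show ?thesis
    using energy_norm_nonneg[OF a, of L "R t"] by (simp add: R_def)
qed

section \<open>An eigenvalue near the imaginary axis\<close>

text \<open>
  The logarithmic derivative of \<open>p\<close> at \<open>w\<close> is the sum of the terms \<open>1 / (w - z)\<close> over the roots \<open>z\<close>,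
  each of modulus at most \<open>1 / d\<close>. The induction removes one linear factor at a time.
\<close>

lemma poly_deriv_bound:
  fixes p :: "complex poly"
  assumes "d \<ge> 0" "\<And>z. poly p z = 0 \<Longrightarrow> d \<le> cmod (w - z)"
  shows "cmod (poly (pderiv p) w) * d \<le> real (degree p) * cmod (poly p w)"
  using assms(2)
proof (induction "degree p" arbitrary: p)
  case 0
  then obtain c where "p = [:c:]" by (metis degree_eq_zeroE)
  then show ?case by (simp add: pderiv_pCons)
next
  case (Suc n)
  then have "\<not> constant (poly p)" by (simp add: constant_degree)
  then obtain r where r: "poly p r = 0" using fundamental_theorem_of_algebra by blast
  then obtain q where p: "p = [:-r, 1:] * q" by (metis dvdE poly_eq_0_iff_dvd)
  have "p \<noteq> 0" using Suc.hyps(2) by auto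
  then have q: "q \<noteq> 0" using p by auto
  have deg: "degree p = Suc (degree q)"
    unfolding p using q by (subst degree_mult_eq) auto
  have IH: "cmod (poly (pderiv q) w) * d \<le> real (degree q) * cmod (poly q w)"
    using Suc deg by (simp add: p)
  have d: "d \<le> cmod (w - r)" using Suc.prems r by blast
  have "poly (pderiv p) w = poly q w + (w - r) * poly (pderiv q) w"
    unfolding p pderiv_mult by (simp add: pderiv_pCons algebra_simps)
  then have "cmod (poly (pderiv p) w) \<le> cmod (poly q w) + cmod (w - r) * cmod (poly (pderiv q) w)"
    by (metis norm_mult norm_triangle_ineq)
  from mult_right_mono[OF this assms(1)]
  have "cmod (poly (pderiv p) w) * d \<le>
      cmod (poly q w) * d + cmod (w - r) * (cmod (poly (pderiv q) w) * d)"
    by (simp add: distrib_right mult.assoc)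
  also have "\<dots> \<le> cmod (poly q w) * cmod (w - r) + cmod (w - r) * (real (degree q) * cmod (poly q w))"
    using d IH by (intro add_mono mult_left_mono) auto
  also have "\<dots> = real (Suc (degree q)) * (cmod (w - r) * cmod (poly q w))"
    by (simp add: algebra_simps)
  also have "cmod (w - r) * cmod (poly q w) = cmod (poly p w)"
    unfolding p poly_mult norm_mult by simp
  finally have "cmod (poly (pderiv p) w) * d \<le> real (degree p) * cmod (poly p w)"
    unfolding deg .
  then show ?case .
qed

lemma poly_root_near:
  fixes p :: "complex poly"
  assumes R: "real (degree p) * cmod (poly p w) < cmod (poly (pderiv p) w) * R"
  shows "\<exists>z. poly p z = 0 \<and> cmod (z - w) \<le> R"
proof (rule ccontr)
  assume "\<not> ?thesis"
  then have *: "R \<le> cmod (w - z)" if "poly p z = 0" for z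
    using that by (force simp: norm_minus_commute)
  have "0 < cmod (poly (pderiv p) w) * R"
    using R by (rule le_less_trans[rotated]) simp
  then have "R \<ge> 0" by (simp add: zero_less_mult_iff)
  then have "cmod (poly (pderiv p) w) * R \<le> real (degree p) * cmod (poly p w)"
    by (rule poly_deriv_bound) (rule *)
  with R show False by simp
qed

text \<open>
  At \<open>w = \<i> k\<close> the polynomial has the value \<open>- c\<^sup>2 k\<^sup>2\<close>, because the first factor vanishes, and its
  derivative has real part \<open>- 2 b k\<^sup>4\<close>. So there is a root within \<open>4 \<cdot> c\<^sup>2 k\<^sup>2 / (2 b k\<^sup>4)\<close> of \<open>w\<close>; the
  bound stated is twice that, to meet the strict inequality in \<open>poly_root_near\<close>.
\<close>

lemma characteristic_root:
  fixes a b c k :: real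
  assumes b: "b > 0" and c: "c > 0" and k: "k > 0"
  shows "\<exists>z::complex. (z\<^sup>2 + k\<^sup>2) * (z\<^sup>2 + (a + b * z) * k\<^sup>2) + c\<^sup>2 * z\<^sup>2 = 0
    \<and> cmod (z - \<i> * k) \<le> 4 * c\<^sup>2 / (b * k\<^sup>2)"
proof -
  define p :: "complex poly" where
    "p = [:of_real (k\<^sup>2), 0, 1:] * [:of_real (a * k\<^sup>2), of_real (b * k\<^sup>2), 1:] + [:0, 0, of_real (c\<^sup>2):]"
  have poly_p: "poly p z = (z\<^sup>2 + k\<^sup>2) * (z\<^sup>2 + (a + b * z) * k\<^sup>2) + c\<^sup>2 * z\<^sup>2" for z :: complex
    by (simp add: p_def algebra_simps power2_eq_square)
  have deg: "degree p \<le> 4"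
    unfolding p_def by (intro degree_add_le order_trans[OF degree_mult_le]) auto
  have "poly p (\<i> * k) = - of_real (c\<^sup>2 * k\<^sup>2)"
    by (simp add: poly_p[of "\<i> * k"] power_mult_distrib)
  then have pw: "cmod (poly p (\<i> * k)) = c\<^sup>2 * k\<^sup>2"
    by (simp only: norm_minus_cancel norm_of_real) simp
  have "Re (poly (pderiv p) (\<i> * k)) = - 2 * b * k ^ 4"
    by (simp add: p_def pderiv_mult pderiv_add pderiv_pCons algebra_simps power2_eq_square power4_eq_xxxx)
  then have p'w: "2 * b * k ^ 4 \<le> cmod (poly (pderiv p) (\<i> * k))"
    using abs_Re_le_cmod[of "poly (pderiv p) (\<i> * k)"] by linarith
  have "real (degree p) * cmod (poly p (\<i> * k)) \<le> 4 * (c\<^sup>2 * k\<^sup>2)"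
    unfolding pw using deg by (intro mult_right_mono) auto
  also have "\<dots> < 2 * b * k ^ 4 * (4 * c\<^sup>2 / (b * k\<^sup>2))"
    using b c k by (simp add: power2_eq_square power4_eq_xxxx)
  also have "\<dots> \<le> cmod (poly (pderiv p) (\<i> * k)) * (4 * c\<^sup>2 / (b * k\<^sup>2))"
    using p'w b by (intro mult_right_mono) auto
  finally show ?thesis
    unfolding poly_p[symmetric] by (rule poly_root_near)
qed

section \<open>Eigenmodes\<close>

lemma L2_cong:
  assumes "\<And>x. x \<in> {0<..<L} \<Longrightarrow> f x = g x"
  shows "f \<in> L2 L \<longleftrightarrow> g \<in> L2 L"
proof -
  have "f \<in> borel_measurable (interval_measure L) \<longleftrightarrow> g \<in> borel_measurable (interval_measure L)"
    by (rule measurable_lebesgue_cong[OF assms])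
  moreover have "integrable (interval_measure L) (\<lambda>x. (cmod (f x))\<^sup>2) \<longleftrightarrow>
      integrable (interval_measure L) (\<lambda>x. (cmod (g x))\<^sup>2)"
    by (rule Bochner_Integration.integrable_cong[OF refl]) (simp add: assms)
  ultimately show ?thesis by (simp add: L2_def)
qed

lemma has_weak_deriv_cong_AE:
  assumes "f \<in> L2 L" "has_weak_deriv L g g'" "AE x in interval_measure L. f x = g x"
  shows "has_weak_deriv L f g'"
  using has_weak_deriv_cong[of f L g g'] assms by (auto simp: has_weak_deriv_def)

definition mode :: "real \<Rightarrow> complex \<Rightarrow> complex \<Rightarrow> complex \<Rightarrow> state" where
  "mode k l \<alpha> \<beta> = (\<lambda>x. \<alpha> * of_real (sin (k * x)), \<lambda>x. l * \<alpha> * of_real (sin (k * x)),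
     \<lambda>x. \<beta> * of_real (sin (k * x)), \<lambda>x. l * \<beta> * of_real (sin (k * x)))"

lemma
  fixes \<alpha> :: complex
  assumes L: "L > 0"
  shows sin_weak_deriv: "has_weak_deriv L (\<lambda>x. \<alpha> * of_real (sin (k * x))) (\<lambda>x. \<alpha> * k * of_real (cos (k * x)))"
    and cos_weak_deriv: "has_weak_deriv L (\<lambda>x. \<alpha> * of_real (cos (k * x))) (\<lambda>x. - \<alpha> * k * of_real (sin (k * x)))"
proof -
  have "((\<lambda>x. sin (k * x)) has_real_derivative k * cos (k * x)) (at x)" for x
    by (auto intro!: derivative_eq_intros)
  note s = has_vector_derivative_of_real_field[OF this]
  have "has_weak_deriv L (\<lambda>x. of_real (sin (k * x))) (\<lambda>x. of_real (k * cos (k * x)))"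
    by (rule has_weak_deriv_C1[OF L s]) (intro continuous_intros)
  from has_weak_deriv_scale[OF this, of \<alpha>]
  show "has_weak_deriv L (\<lambda>x. \<alpha> * of_real (sin (k * x))) (\<lambda>x. \<alpha> * k * of_real (cos (k * x)))"
    by (simp add: mult.assoc)
  have "((\<lambda>x. cos (k * x)) has_real_derivative - k * sin (k * x)) (at x)" for x
    by (auto intro!: derivative_eq_intros)
  note c = has_vector_derivative_of_real_field[OF this]
  have "has_weak_deriv L (\<lambda>x. of_real (cos (k * x))) (\<lambda>x. of_real (- k * sin (k * x)))"
    by (rule has_weak_deriv_C1[OF L c]) (intro continuous_intros)
  from has_weak_deriv_scale[OF this, of \<alpha>]
  show "has_weak_deriv L (\<lambda>x. \<alpha> * of_real (cos (k * x))) (\<lambda>x. - \<alpha> * k * of_real (sin (k * x)))"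
    by (simp add: mult.assoc)
qed

lemma mode_energy_space:
  assumes "L > 0" "k > 0" "sin (k * L) = 0"
  shows "mode k l \<alpha> \<beta> \<in> energy_space L"
  using H10_scale[OF assms(1) sin_H10[OF assms]]
  by (auto simp: mode_def energy_space_def intro!: H1_L2 H10_H1)

text \<open>
  The two equations are the eigenvalue equation in the coordinates \<open>\<alpha>\<close> and \<open>\<beta>\<close>. The classical
  derivatives of sine and cosine agree with the chosen weak derivatives only almost everywhere, so
  regularity passes from the former to the latter by \<open>has_weak_deriv_cong_AE\<close>.
\<close>

lemma mode_eigenvector:
  fixes L a b0 c0 k :: real and b c :: "real \<Rightarrow> real" and l \<alpha> \<beta> :: complex
  assumes L: "L > 0" and k: "k > 0" "sin (k * L) = 0"
    and b: "\<forall>x\<in>{0<..<L}. b x = b0" and c: "\<forall>x\<in>{0<..<L}. c x = c0"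
    and eq1: "l\<^sup>2 * \<alpha> = - (a + b0 * l) * k\<^sup>2 * \<alpha> - c0 * l * \<beta>"
    and eq2: "l\<^sup>2 * \<beta> = - k\<^sup>2 * \<beta> + c0 * l * \<alpha>"
  shows "mode k l \<alpha> \<beta> \<in> A_dom L a b"
    and "A_op L a b c (mode k l \<alpha> \<beta>) \<in> finite_energy L"
    and "state_eq L (state_scale l (mode k l \<alpha> \<beta>)) (A_op L a b c (mode k l \<alpha> \<beta>))"
proof -
  define s :: "real \<Rightarrow> complex" where "s x = of_real (sin (k * x))" for x
  define u v y z where "u = (\<lambda>x. \<alpha> * s x)" and "v = (\<lambda>x. l * \<alpha> * s x)"
    and "y = (\<lambda>x. \<beta> * s x)" and "z = (\<lambda>x. l * \<beta> * s x)"
  note uvyz = u_def v_def y_def z_def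
  have mode: "mode k l \<alpha> \<beta> = (u, v, y, z)"
    by (simp add: mode_def uvyz s_def)
  define s' :: "real \<Rightarrow> complex" where "s' x = of_real (cos (k * x))" for x
  have H10: "(\<lambda>x. w * s x) \<in> H10 L" for w
    using H10_scale[OF L sin_H10[OF L k]] by (simp add: s_def)
  have ds: "has_weak_deriv L (\<lambda>x. w * s x) (\<lambda>x. w * k * s' x)" for w
    using sin_weak_deriv[OF L] by (simp add: s_def s'_def)
  have ds': "has_weak_deriv L (\<lambda>x. w * s' x) (\<lambda>x. - w * k * s x)" for w
    using cos_weak_deriv[OF L] by (simp add: s_def s'_def)
  have sH1: "(\<lambda>x. w * s x) \<in> H1 L" for w by (rule H10_H1[OF H10])
  note sL2 = H1_L2[OF sH1]
  define F where "F = flux L a b u v"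
  have wu: "AE x in interval_measure L. weak_deriv L u x = \<alpha> * k * s' x"
    and wv: "AE x in interval_measure L. weak_deriv L v x = l * \<alpha> * k * s' x"
    and wy: "AE x in interval_measure L. weak_deriv L y x = \<beta> * k * s' x"
    using weak_deriv_AE[OF ds] by (auto simp: uvyz)
  have y': "has_weak_deriv L (weak_deriv L y) (\<lambda>x. - (\<beta> * k) * k * s x)"
    by (rule has_weak_deriv_cong_AE[OF _ ds' wy]) (simp add: y_def weak_deriv_L2 sH1)
  have wF: "AE x in interval_measure L. F x = (a + b0 * l) * \<alpha> * k * s' x"
    using wu wv AE_space by eventually_elim (simp add: F_def flux_def b algebra_simps)
  have FL2: "F \<in> L2 L"
  proof -
    have "F \<in> L2 L \<longleftrightarrow> (\<lambda>x. of_real a * weak_deriv L u x + of_real b0 * weak_deriv L v x) \<in> L2 L"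
      by (rule L2_cong) (simp add: F_def flux_def b)
    then show ?thesis
      by (simp add: uvyz L2_add L2_scale weak_deriv_L2 sH1)
  qed
  have F': "has_weak_deriv L F (\<lambda>x. - ((a + b0 * l) * \<alpha> * k) * k * s x)"
    by (rule has_weak_deriv_cong_AE[OF FL2 ds' wF])
  have H1: "weak_deriv L y \<in> H1 L" "F \<in> H1 L"
    using y' F' by (auto simp: H1_def)
  show "mode k l \<alpha> \<beta> \<in> A_dom L a b"
    using mode_energy_space[OF L k, of l \<alpha> \<beta>] H10 sH1 H1
    by (auto simp: mode A_dom_def H2_def F_def uvyz)
  have c': "(\<lambda>x. weak_deriv L F x - of_real (c x) * z x) \<in> L2 L"
  proof -
    have "(\<lambda>x. weak_deriv L F x - of_real (c x) * z x) \<in> L2 L \<longleftrightarrow>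
        (\<lambda>x. weak_deriv L F x + (- of_real c0) * z x) \<in> L2 L"
      by (rule L2_cong) (simp add: c)
    then show ?thesis
      using L2_add[OF weak_deriv_L2[OF H1(2)] L2_scale[OF sL2, of "- of_real c0" "l * \<beta>"]]
      by (simp add: z_def)
  qed
  have c'': "(\<lambda>x. weak_deriv L (weak_deriv L y) x + of_real (c x) * v x) \<in> L2 L"
  proof -
    have "(\<lambda>x. weak_deriv L (weak_deriv L y) x + of_real (c x) * v x) \<in> L2 L \<longleftrightarrow>
        (\<lambda>x. weak_deriv L (weak_deriv L y) x + of_real c0 * v x) \<in> L2 L"
      by (rule L2_cong) (simp add: c)
    then show ?thesis
      using L2_add[OF weak_deriv_L2[OF H1(1)] L2_scale[OF sL2, of "of_real c0" "l * \<alpha>"]]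
      by (simp add: v_def)
  qed
  show "A_op L a b c (mode k l \<alpha> \<beta>) \<in> finite_energy L"
    using c' c'' sH1 by (simp add: mode finite_energy_def F_def v_def z_def)
  have "AE x in interval_measure L. l * v x = weak_deriv L F x - of_real (c x) * z x"
    using weak_deriv_AE[OF F'] AE_space
  proof eventually_elim
    case (elim x)
    have "l * v x = (l\<^sup>2 * \<alpha>) * s x" by (simp add: v_def power2_eq_square)
    also have "\<dots> = weak_deriv L F x - of_real (c x) * z x"
      unfolding eq1 using elim by (simp add: c z_def algebra_simps power2_eq_square)
    finally show ?case .
  qed
  moreover have "AE x in interval_measure L. l * z x = weak_deriv L (weak_deriv L y) x + of_real (c x) * v x"
    using weak_deriv_AE[OF y'] AE_space
  proof eventually_elim
    case (elim x)
    have "l * z x = (l\<^sup>2 * \<beta>) * s x" by (simp add: z_def power2_eq_square)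
    also have "\<dots> = weak_deriv L (weak_deriv L y) x + of_real (c x) * v x"
      unfolding eq2 using elim by (simp add: c v_def algebra_simps power2_eq_square)
    finally show ?case .
  qed
  ultimately show "state_eq L (state_scale l (mode k l \<alpha> \<beta>)) (A_op L a b c (mode k l \<alpha> \<beta>))"
    by (simp add: mode F_def[symmetric]) (simp add: uvyz mult.assoc)
qed

lemma interval_measure_not_AE_False:
  assumes "L > 0"
  shows "\<not> (AE x in interval_measure L. False)"
proof
  assume "AE x in interval_measure L. False"
  then have "emeasure (interval_measure L) {0<..<L} = 0"
    using AE_iff_measurable[of "{0<..<L}" "interval_measure L" "\<lambda>_. False", OF sets_lebesgue_on_refl]
    by (metis (no_types, lifting) Collect_cong Collect_mem_eq space_lebesgue_on)
  then show False
    using assms by (simp add: emeasure_restrict_space)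
qed

text \<open>
  If the energy vanishes then \<open>sin (k x)\<close> and \<open>cos (k x)\<close>, which come from the fourth component and from
  the derivative of the third, are both 0 for almost every \<open>x\<close>.
\<close>

lemma mode_energy_pos:
  assumes L: "L > 0" and a: "a > 0" and k: "k > 0" "sin (k * L) = 0" and nz: "l \<noteq> 0" "\<beta> \<noteq> 0"
  shows "energy_norm L a (mode k l \<alpha> \<beta>) > 0"
proof -
  let ?U = "mode k l \<alpha> \<beta>"
  let ?e = "energy_density L a ?U"
  have int: "sq_integrable (interval_measure L) ?e"
    by (intro sq_integrable_energy_density energy_space_finite_energy mode_energy_space L k)
  have "(LINT x|interval_measure L. (norm (?e x))\<^sup>2) \<noteq> 0"
  proof
    assume "(LINT x|interval_measure L. (norm (?e x))\<^sup>2) = 0"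
    then have "AE x in interval_measure L. (norm (?e x))\<^sup>2 = 0"
      using int by (subst (asm) integral_nonneg_eq_0_iff_AE) (auto simp: sq_integrable_def)
    moreover have "AE x in interval_measure L.
        weak_deriv L (\<lambda>x. \<beta> * of_real (sin (k * x))) x = \<beta> * k * of_real (cos (k * x))"
      by (rule weak_deriv_AE[OF sin_weak_deriv[OF L]])
    ultimately have "AE x in interval_measure L. False"
    proof eventually_elim
      case (elim x)
      then have "?e x = 0" by simp
      then have "sin (k * x) = 0" "weak_deriv L (\<lambda>x. \<beta> * of_real (sin (k * x))) x = 0"
        using nz by (auto simp: mode_def zero_prod_def)
      then show ?case
        using elim nz k sin_zero_abs_cos_one[of "k * x"] by auto
    qed
    then show False using interval_measure_not_AE_False[OF L] by simp
  qed
  then have "norm2 (interval_measure L) ?e \<noteq> 0"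
    by (simp add: norm2_def)
  then show ?thesis
    using energy_norm_nonneg[OF a, of L ?U] by (simp add: energy_norm_eq[OF a])
qed

lemma energy_eigenvector_ge:
  assumes L: "L > 0" and a: "a > 0" and T: "contraction_semigroup L a T"
    and gen: "(U, state_scale l U) \<in> generator_graph L a T" and t: "t > 0"
  shows "exp (2 * Re l * t) * (energy_norm L a U)\<^sup>2 / 2 \<le> energy L a T U t"
proof -
  let ?N = "energy_norm L a"
  let ?e = "exp (l * of_real t)"
  have U: "U \<in> energy_space L" using gen by (simp add: generator_graph_def)
  have TU: "T t U \<in> energy_space L"
    using T U t by (simp add: contraction_semigroup_def)
  note fe = energy_space_finite_energy
  define D where "D = state_diff (T t U) (state_scale ?e U)"
  have D: "D \<in> finite_energy L"
    unfolding D_def state_diff_scale by (intro finite_energy_lincomb fe TU U)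
  have D0: "?N D = 0" unfolding D_def by (rule semigroup_eigenvector[OF L a T gen t])
  obtain u v y z where Uc: "U = (u, v, y, z)" by (metis prod_cases4)
  obtain u' v' y' z' where Tc: "T t U = (u', v', y', z')" by (metis prod_cases4)
  have "state_scale ?e U = state_add (T t U) (state_scale (-1) D)"
    unfolding D_def Tc by (simp add: Uc state_diff_def)
  then have "?N (state_scale ?e U) \<le> ?N (T t U) + cmod (-1) * ?N D"
    using energy_norm_lincomb[OF a fe[OF TU] D, of "-1"] by simp
  then have "exp (Re l * t) * ?N U \<le> ?N (T t U)"
    by (simp add: D0 energy_norm_scale[OF a fe[OF U]] norm_exp_eq_Re)
  then have "(exp (Re l * t) * ?N U)\<^sup>2 \<le> (?N (T t U))\<^sup>2"
    using energy_norm_nonneg[OF a, of L U] by (intro power_mono) auto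
  then show ?thesis
    by (simp add: energy_def power_mult_distrib exp_double[symmetric] mult.assoc)
qed

section \<open>The decay rate\<close>

lemma cancel_square_factor:
  fixes n :: real
  assumes "x * n\<^sup>2 / 2 \<le> y * (z * n)\<^sup>2" "n > 0"
  shows "x / 2 \<le> y * z\<^sup>2"
proof (rule mult_right_le_imp_le)
  show "x / 2 * n\<^sup>2 \<le> y * z\<^sup>2 * n\<^sup>2"
    using assms(1) by (simp add: power_mult_distrib)
  show "0 < n\<^sup>2" using assms(2) by simp
qed

theorem theorem3p1:
  fixes L a b0 c0 :: real and b c :: "real \<Rightarrow> real" and T :: "real \<Rightarrow> state \<Rightarrow> state"
  assumes "L > 0" and "a > 0" and "b0 > 0" and "c0 > 0"
    and "\<forall>x\<in>{0<..<L}. b x = b0"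
    and "\<forall>x\<in>{0<..<L}. c x = c0"
    and "generates_contraction_semigroup L a b c T"
  shows "\<exists>\<epsilon>0>0. \<forall>\<epsilon>. 0 < \<epsilon> \<and> \<epsilon> < \<epsilon>0 \<longrightarrow>
           \<not> (\<exists>C>0. \<forall>t>0. \<forall>U0\<in>A_dom L a b.
                energy L a T U0 t \<le> C / t powr (2 / (2 - \<epsilon>)) * (graph_norm L a b c U0)\<^sup>2)"
proof (intro exI[of _ 1] conjI allI impI notI)
  show "(0::real) < 1" by simp
  fix \<epsilon> :: real
  assume \<epsilon>: "0 < \<epsilon> \<and> \<epsilon> < 1"
  assume "\<exists>C>0. \<forall>t>0. \<forall>U0\<in>A_dom L a b.
      energy L a T U0 t \<le> C / t powr (2 / (2 - \<epsilon>)) * (graph_norm L a b c U0)\<^sup>2"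
  then obtain C where C: "C > 0" and decay: "\<And>t U. t > 0 \<Longrightarrow> U \<in> A_dom L a b \<Longrightarrow>
      energy L a T U t \<le> C / t powr (2 / (2 - \<epsilon>)) * (graph_norm L a b c U)\<^sup>2"
    by blast
  define p where "p = 2 / (2 - \<epsilon>)"
  have p: "p > 1" using \<epsilon> by (simp add: p_def field_simps)
  define K where "K = 4 * c0\<^sup>2 / b0"
  have K: "K > 0" using assms by (simp add: K_def)
  have T: "contraction_semigroup L a T"
    and gen: "generator_graph L a T =
       {(U, F). U \<in> A_dom L a b \<and> F \<in> energy_space L \<and> state_eq L F (A_op L a b c U)}"
    using assms(7) by (auto simp: generates_contraction_semigroup_def)
  note L = assms(1) and a = assms(2)
  have mode_bound: "exp (- 2 * K) / 2 \<le> C * (2 + K)\<^sup>2 * (k\<^sup>2) powr (1 - p)"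
    if k: "k \<ge> 1" "sin (k * L) = 0" for k
  proof -
    have k0: "k > 0" using k by simp
    obtain l :: complex where root: "(l\<^sup>2 + k\<^sup>2) * (l\<^sup>2 + (a + b0 * l) * k\<^sup>2) + c0\<^sup>2 * l\<^sup>2 = 0"
      and near: "cmod (l - \<i> * k) \<le> 4 * c0\<^sup>2 / (b0 * k\<^sup>2)"
      using characteristic_root[OF assms(3,4) k0, of a] by blast
    have l0: "l \<noteq> 0" using root k0 a by auto
    define \<alpha> \<beta> where "\<alpha> = l\<^sup>2 + of_real (k\<^sup>2)" and "\<beta> = of_real c0 * l"
    have eq1: "l\<^sup>2 * \<alpha> = - (a + b0 * l) * k\<^sup>2 * \<alpha> - c0 * l * \<beta>"
    proof -
      have "l\<^sup>2 * \<alpha> - (- (a + b0 * l) * k\<^sup>2 * \<alpha> - c0 * l * \<beta>) =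
          (l\<^sup>2 + k\<^sup>2) * (l\<^sup>2 + (a + b0 * l) * k\<^sup>2) + c0\<^sup>2 * l\<^sup>2"
        by (simp add: \<alpha>_def \<beta>_def algebra_simps power2_eq_square)
      then show ?thesis using root by simp
    qed
    have eq2: "l\<^sup>2 * \<beta> = - k\<^sup>2 * \<beta> + c0 * l * \<alpha>"
      by (simp add: \<alpha>_def \<beta>_def algebra_simps)
    define U where "U = mode k l \<alpha> \<beta>"
    note eig = mode_eigenvector[OF L k0 k(2) assms(5,6) eq1 eq2, folded U_def]
    have U: "U \<in> energy_space L"
      unfolding U_def by (rule mode_energy_space[OF L k0 k(2)])
    have g: "(U, state_scale l U) \<in> generator_graph L a T"
      unfolding gen using eig(1,3) energy_space_scale[OF L U] by simp
    let ?N = "energy_norm L a U"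
    have N: "?N > 0"
      unfolding U_def by (rule mode_energy_pos[OF L a k0 k(2)]) (use l0 assms(4) in \<open>auto simp: \<beta>_def\<close>)
    have "energy_norm L a (A_op L a b c U) = cmod l * ?N"
      using energy_norm_cong[OF a finite_energy_scale[OF energy_space_finite_energy[OF U]] eig(2,3)]
        energy_norm_scale[OF a energy_space_finite_energy[OF U]] by simp
    then have graph: "graph_norm L a b c U = (1 + cmod l) * ?N"
      by (simp add: graph_norm_def algebra_simps)
    have t: "k\<^sup>2 > 0" using k0 by simp
    \<comment> \<open>The time \<open>k\<^sup>2\<close> is the longest, up to a factor, for which the fraction of energy left is bounded below uniformly in \<open>k\<close>.\<close>
    have "exp (2 * Re l * k\<^sup>2) * ?N\<^sup>2 / 2 \<le> C / (k\<^sup>2) powr p * ((1 + cmod l) * ?N)\<^sup>2"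
      using order_trans[OF energy_eigenvector_ge[OF L a T g t] decay[OF t eig(1)]]
      by (simp only: graph p_def)
    then have main: "exp (2 * Re l * k\<^sup>2) / 2 \<le> C / (k\<^sup>2) powr p * (1 + cmod l)\<^sup>2"
      using N by (rule cancel_square_factor)
    have near': "cmod (l - \<i> * k) \<le> K / k\<^sup>2"
      using near by (simp add: K_def)
    have "- (K / k\<^sup>2) \<le> Re l"
      using abs_Re_le_cmod[of "l - \<i> * k"] near' by simp
    then have "- K \<le> Re l * k\<^sup>2" using t by (simp add: field_simps)
    then have "exp (- 2 * K) / 2 \<le> exp (2 * Re l * k\<^sup>2) / 2" by simp
    also note main
    also have "C / (k\<^sup>2) powr p * (1 + cmod l)\<^sup>2 \<le> C / (k\<^sup>2) powr p * ((2 + K) * k)\<^sup>2"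
    proof -
      have "K / k\<^sup>2 \<le> K * k"
      proof -
        have "1 * 1 \<le> k * k\<^sup>2"
          using k by (intro mult_mono one_le_power) auto
        then have "K * 1 \<le> K * (k * k\<^sup>2)"
          using K by (intro mult_left_mono) auto
        then show ?thesis using t by (simp add: pos_divide_le_eq mult.assoc)
      qed
      moreover have "cmod l \<le> cmod (l - \<i> * k) + k"
        using norm_triangle_ineq[of "l - \<i> * k" "\<i> * k"] k0 by (simp add: norm_mult)
      ultimately have "1 + cmod l \<le> (2 + K) * k"
        using near' k by (simp add: algebra_simps)
      then show ?thesis using C by (intro mult_left_mono power_mono) auto
    qed
    also have "\<dots> = C * (2 + K)\<^sup>2 * (k\<^sup>2) powr (1 - p)"
      using t by (simp add: powr_diff power_mult_distrib)
    finally show ?thesis .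
  qed
  define k where "k n = pi / L * real n" for n
  have k_top: "filterlim k at_top sequentially"
    unfolding k_def using L
    by (intro filterlim_tendsto_pos_mult_at_top[OF tendsto_const] filterlim_real_sequentially) simp
  have sin0: "sin (k n * L) = 0" for n
    using L by (simp add: k_def mult.commute)
  have "\<forall>\<^sub>F n in sequentially. 1 \<le> k n"
    using k_top by (simp add: filterlim_at_top)
  then have "\<forall>\<^sub>F n in sequentially. exp (- 2 * K) / 2 \<le> C * (2 + K)\<^sup>2 * ((k n)\<^sup>2) powr (1 - p)"
    by eventually_elim (rule mode_bound[OF _ sin0])
  moreover have "(\<lambda>n. C * (2 + K)\<^sup>2 * ((k n)\<^sup>2) powr (1 - p)) \<longlonglongrightarrow> C * (2 + K)\<^sup>2 * 0"
    using p by (intro tendsto_mult_left tendsto_neg_powr filterlim_pow_at_top k_top) auto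
  ultimately have "exp (- 2 * K) / 2 \<le> C * (2 + K)\<^sup>2 * 0"
    by (intro tendsto_lowerbound[where F = sequentially]) auto
  then show False by simp
qed

end
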